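(* Let $m\geq 1$ and let $B_m=\mathbf{Q}[[x_i,x_j]]$ be the Poisson algebra with Poisson bracket $\{x_i,x_j\}=m\,x_ix_j$. In the group ${\rm Aut}(B_m)$ of Poisson automorphisms there exists a factorization $$T_i\circ T_j=\prod^{\leftarrow}_{b/a}T_{a,b}^{\,d(a,b)},$$ the product running over all $(a,b)\in\mathbf{N}^2\setminus\{(0,0)\}$, ordered by decreasing ratio $b/a\in\mathbf{Q}_{\geq0}\cup\{\infty\}$ from left to right, where $d(a,b)\in\frac{1}{\gcd(a,b)}\mathbf{Z}$ for all $a,b$.
   Context: $\mathbf{N}$ contains $0$. For $(a,b)\in\mathbf{N}^2\setminus\{(0,0)\}$, the automorphism $T_{a,b}$ of $B_m$ is given by $$T_{a,b}:\ x_i\mapsto x_i(1+x_i^ax_j^b)^{-mb},\qquad x_j\mapsto x_j(1+x_i^ax_j^b)^{ma},$$ and $T_i=T_{1,0}$, $T_j=T_{0,1}$. Note that $T_{a,b}$ fixes $x_i^ax_j^b$; for rational $r$, the power $T_{a,b}^r$ is the automorphism $x_i\mapsto x_i(1+x_i^ax_j^b)^{-mbr}$, $x_j\mapsto x_j(1+x_i^ax_j^b)^{mar}$ (powers of series with constant term $1$ being defined by the binomial series). Automorphisms $T_{a,b}^r$ and $T_{a',b'}^{r'}$ with $b/a=b'/a'$ commute, so their relative order is irrelevant. The infinite ordered product is the coefficientwise limit, as $N\to\infty$, of the finite compositions over all $(a,b)$ with $1\le a+b\leq N$, ordered by decreasing $b/a$ from left to right, where $b/a=\infty$ if $a=0$.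 (This is the setting of the $m$-arrow Kronecker quiver with vertices $i,j$ and $m$ arrows from $j$ to $i$.) *)

theory Defs
  imports "HOL-Computational_Algebra.Formal_Power_Series" "HOL-Library.Extended_Real"
begin

text \<open>
  The algebra of formal power series in two variables \<open>x\<^sub>i\<close>, \<open>x\<^sub>j\<close> over the rationals is
  realised as series in \<open>x\<^sub>j\<close> with coefficients in the series in \<open>x\<^sub>i\<close>. Its ring structure is the
  one of the library, but the library's metric on it is not used: it is the \<open>x\<^sub>j\<close>-adic one, whereas
  limits here are taken coefficient by coefficient.
\<close>

type_synonym bps = "rat fps fps"

definition xi :: bps where "xi = fps_const fps_X"

definition xj :: bps where "xj = fps_X"

definition bscalar :: "rat \<Rightarrow> bps" where "bscalar c = fps_const (fps_const c)"

text \<open>Coefficient of \<open>x\<^sub>i\<^sup>p x\<^sub>j\<^sup>q\<close>; the outer index belongs to \<open>x\<^sub>j\<close>.\<close>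

definition bcoeff :: "bps \<Rightarrow> nat \<Rightarrow> nat \<Rightarrow> rat" where
  "bcoeff F p q = fps_nth (fps_nth F q) p"

definition bps_of :: "(nat \<Rightarrow> nat \<Rightarrow> rat) \<Rightarrow> bps" where
  "bps_of c = Abs_fps (\<lambda>q. Abs_fps (\<lambda>p. c p q))"

definition deriv_i :: "bps \<Rightarrow> bps" where
  "deriv_i F = Abs_fps (\<lambda>q. fps_deriv (fps_nth F q))"

definition deriv_j :: "bps \<Rightarrow> bps" where
  "deriv_j F = fps_deriv F"

text \<open>
  The Poisson bracket on formal series determined by \<open>{x\<^sub>i, x\<^sub>j} = m x\<^sub>i x\<^sub>j\<close>: it is a derivation in
  each argument, so its value on \<open>F\<close>, \<open>G\<close> is \<open>{x\<^sub>i, x\<^sub>j}\<close> times the Jacobian determinant.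
\<close>

definition bracket :: "nat \<Rightarrow> bps \<Rightarrow> bps \<Rightarrow> bps" where
  "bracket m F G =
     of_nat m * xi * xj * (deriv_i F * deriv_j G - deriv_j F * deriv_i G)"

text \<open>The group law on these automorphisms is composition of maps.\<close>

definition poisson_aut :: "nat \<Rightarrow> (bps \<Rightarrow> bps) set" where
  "poisson_aut m = {\<phi>. bij \<phi> \<and>
     (\<forall>F G. \<phi> (F + G) = \<phi> F + \<phi> G) \<and>
     (\<forall>F G. \<phi> (F * G) = \<phi> F * \<phi> G) \<and>
     (\<forall>c. \<phi> (bscalar c) = bscalar c) \<and>
     (\<forall>F G. \<phi> (bracket m F G) = bracket m (\<phi> F) (\<phi> G))}"

text \<open>
  The series \<open>F(A, B)\<close>, for \<open>A\<close> and \<open>B\<close> without constant term. Then \<open>A\<^sup>k B\<^sup>l\<close> has order at least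
  \<open>k + l\<close>, so the omitted terms do not contribute to the coefficient of \<open>x\<^sub>i\<^sup>p x\<^sub>j\<^sup>q\<close>.
\<close>

definition bsubst :: "bps \<Rightarrow> bps \<Rightarrow> bps \<Rightarrow> bps" where
  "bsubst A B F = bps_of (\<lambda>p q.
     \<Sum>k\<le>p + q. \<Sum>l\<le>p + q. bcoeff F k l * bcoeff (A ^ k * B ^ l) p q)"

text \<open>
  The power \<open>U\<^sup>s = \<Sum>n. (s choose n) (U - 1)\<^sup>n\<close>, for \<open>U\<close> with constant term 1. Then \<open>(U - 1)\<^sup>n\<close> has
  order at least \<open>n\<close>, which justifies the truncation.
\<close>

definition bpower :: "bps \<Rightarrow> rat \<Rightarrow> bps" where
  "bpower U s = bps_of (\<lambda>p q. \<Sum>n\<le>p + q. (s gchoose n) * bcoeff ((U - 1) ^ n) p q)"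

text \<open>\<open>T_pow m a b r\<close> is \<open>T\<^sub>a\<^sub>,\<^sub>b\<^sup>r\<close>; it is only meaningful for \<open>(a, b) \<noteq> (0, 0)\<close>.\<close>

definition T_pow :: "nat \<Rightarrow> nat \<Rightarrow> nat \<Rightarrow> rat \<Rightarrow> bps \<Rightarrow> bps" where
  "T_pow m a b r = bsubst
     (xi * bpower (1 + xi ^ a * xj ^ b) (- (of_nat m * of_nat b * r)))
     (xj * bpower (1 + xi ^ a * xj ^ b) (of_nat m * of_nat a * r))"

definition T :: "nat \<Rightarrow> nat \<Rightarrow> nat \<Rightarrow> bps \<Rightarrow> bps" where
  "T m a b = T_pow m a b 1"

definition slope :: "nat \<times> nat \<Rightarrow> ereal" where
  "slope = (\<lambda>(a, b). if a = 0 then \<infinity> else ereal (real b / real a))"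

text \<open>
  The list \<open>ps\<close> enumerates the pairs with \<open>1 \<le> a + b \<le> N\<close> by decreasing slope. The relative order
  of pairs with equal slope is left open.
\<close>

definition slope_enum :: "nat \<Rightarrow> (nat \<times> nat) list \<Rightarrow> bool" where
  "slope_enum N ps \<longleftrightarrow> distinct ps \<and> set ps = {(a, b). 1 \<le> a + b \<and> a + b \<le> N} \<and>
     sorted_wrt (\<lambda>u v. slope u \<ge> slope v) ps"

lemma slope_enum_exists: "\<exists>ps. slope_enum N ps"
proof -
  let ?S = "{(a, b). 1 \<le> a + b \<and> a + b \<le> N}"
  have "?S \<subseteq> {..N} \<times> {..N}" by auto
  then have "finite ?S" by (rule finite_subset) auto
  then obtain xs where xs: "set xs = ?S" "distinct xs"
    using finite_distinct_list by blast
  have "sorted_wrt (\<lambda>u v. slope u \<le> slope v) (sort_key slope xs)"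
    using sorted_sort_key[of slope xs] by (simp add: sorted_map)
  then have "slope_enum N (rev (sort_key slope xs))"
    unfolding slope_enum_def using xs by (simp add: sorted_wrt_rev)
  then show ?thesis by blast
qed

definition ordered_prod :: "nat \<Rightarrow> (nat \<Rightarrow> nat \<Rightarrow> rat) \<Rightarrow> (nat \<times> nat) list \<Rightarrow> bps \<Rightarrow> bps" where
  "ordered_prod m d ps = foldr (\<lambda>(a, b) \<phi>. T_pow m a b (d a b) \<circ> \<phi>) ps id"

text \<open>Coefficients converge in the discrete topology, that is, they are eventually constant.\<close>

definition coeffwise_limit :: "(nat \<Rightarrow> bps \<Rightarrow> bps) \<Rightarrow> (bps \<Rightarrow> bps) \<Rightarrow> bool" where
  "coeffwise_limit \<Phi> \<psi> \<longleftrightarrow>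
     (\<forall>F p q. \<forall>\<^sub>F N in sequentially. bcoeff (\<Phi> N F) p q = bcoeff (\<psi> F) p q)"

definition is_factorization :: "nat \<Rightarrow> (nat \<Rightarrow> nat \<Rightarrow> rat) \<Rightarrow> (bps \<Rightarrow> bps) \<Rightarrow> bool" where
  "is_factorization m d \<psi> \<longleftrightarrow>
     (\<forall>ps. (\<forall>N. slope_enum N (ps N)) \<longrightarrow> coeffwise_limit (\<lambda>N. ordered_prod m d (ps N)) \<psi>)"

end

theory Submission imports Defs begin

text \<open>
  Every \<open>T\<^sub>a\<^sub>,\<^sub>b\<^sup>r\<close>, and hence every composition of such maps, has the form
  \<open>x\<^sub>i \<mapsto> x\<^sub>i F\<^sup>m\<close>, \<open>x\<^sub>j \<mapsto> x\<^sub>j G\<^sup>m\<close> with series \<open>F\<close>, \<open>G\<close> of constant term 1. The proof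
  follows these two series, the multipliers of the composition, and constructs the exponents
  \<open>d(a, b)\<close> by induction on the degree \<open>a + b\<close>.

  Suppose that the exponents of degree at most \<open>N\<close> are chosen so that the ordered product over
  these pairs has the multipliers of \<open>T\<^sub>i \<circ> T\<^sub>j\<close> up to degree \<open>N\<close>. Let \<open>u\<close>, \<open>v\<close> be the
  differences of the two pairs of multipliers. Since both maps preserve the Poisson bracket, the
  coefficients of \<open>u\<close>, \<open>v\<close> in degree \<open>a + b = N + 1\<close> satisfy the linearised condition
  \<open>a u\<^sub>a\<^sub>b + b v\<^sub>a\<^sub>b = 0\<close> (\<open>multiplier_leading_divergence\<close>), so that
  \<open>(u\<^sub>a\<^sub>b, v\<^sub>a\<^sub>b) = d(a, b) (- b, a)\<close> for exactly one number \<open>d(a, b)\<close>. This is also the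
  contribution of a factor \<open>T\<^sub>a\<^sub>,\<^sub>b\<^sup>d\<close> to the multipliers in degree \<open>N + 1\<close>, wherever it is
  inserted into the product, because all other factors are the identity to lowest order
  (\<open>multiplier_top_degree\<close>). Inserting all the new factors therefore extends the agreement to
  degree \<open>N + 1\<close> (\<open>extend_factorization\<close>).

  The same step gives the denominators. If \<open>a d(a, b)\<close> and \<open>b d(a, b)\<close> are integers for all pairs
  used so far, then the multipliers have integer coefficients, so \<open>u\<^sub>a\<^sub>b\<close> and \<open>v\<^sub>a\<^sub>b\<close> are integers,
  which means that \<open>a d(a, b)\<close> and \<open>b d(a, b)\<close> are integers for the new pairs too. Bezout's identity
  turns this into \<open>gcd(a, b) d(a, b) \<in> \<int>\<close>. Here it matters that one works with \<open>F\<close>, \<open>G\<close> and not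
  with \<open>F\<^sup>m\<close>, \<open>G\<^sup>m\<close>, whose integrality only bounds the denominators by \<open>m gcd(a, b)\<close>.

  Different enumerations by decreasing slope differ by exchanging pairs on the same ray, whose
  automorphisms commute, so the exponents do not depend on a choice (\<open>multiplier_enum_unique\<close>).

  The formal properties of substitution (it is a ring homomorphism, it composes, it satisfies the
  chain rule) all follow from one principle: two linear maps that are continuous for the total
  degree agree if they agree on monomials (\<open>cont_linear_eqI\<close>).
\<close>

section \<open>Coefficients and the order filtration\<close>

lemma bcoeff_ext: "F = G" if "\<And>p q. bcoeff F p q = bcoeff G p q"
  using that by (auto simp: bcoeff_def fps_eq_iff)

lemma bcoeff_bps_of [simp]: "bcoeff (bps_of c) p q = c p q"
  by (simp add: bcoeff_def bps_of_def)

lemma bcoeff_0 [simp]: "bcoeff 0 p q = 0"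
  by (simp add: bcoeff_def)

lemma bcoeff_add [simp]: "bcoeff (F + G) p q = bcoeff F p q + bcoeff G p q"
  by (simp add: bcoeff_def)

lemma bcoeff_diff [simp]: "bcoeff (F - G) p q = bcoeff F p q - bcoeff G p q"
  by (simp add: bcoeff_def)

lemma bcoeff_sum [simp]: "bcoeff (sum f S) p q = (\<Sum>s\<in>S. bcoeff (f s) p q)"
  by (simp add: bcoeff_def fps_sum_nth)

lemma bcoeff_mult:
  "bcoeff (F * G) p q = (\<Sum>i\<le>q. \<Sum>j\<le>p. bcoeff F j i * bcoeff G (p - j) (q - i))"
  by (simp add: bcoeff_def fps_mult_nth fps_sum_nth atMost_atLeast0)

lemma bcoeff_bscalar_mult [simp]: "bcoeff (bscalar c * F) p q = c * bcoeff F p q"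
  by (simp add: bcoeff_def bscalar_def)

lemma bcoeff_monomial:
  "bcoeff (xi ^ k * xj ^ l) p q = (if p = k \<and> q = l then 1 else 0)"
  by (simp add: bcoeff_def xi_def xj_def fps_const_power fps_mult_left_const_nth)

lemma bcoeff_1 [simp]: "bcoeff 1 p q = (if p = 0 \<and> q = 0 then 1 else 0)"
  using bcoeff_monomial[of 0 0 p q] by simp

lemma bscalar_0 [simp]: "bscalar 0 = 0" and bscalar_1 [simp]: "bscalar 1 = 1"
  and bscalar_add: "bscalar (c + e) = bscalar c + bscalar e"
  and bscalar_mult: "bscalar (c * e) = bscalar c * bscalar e"
  by (simp_all add: bscalar_def fps_const_add[symmetric] fps_const_mult[symmetric]
      del: fps_const_add fps_const_mult)

lemma bscalar_of_nat: "bscalar (of_nat n) = of_nat n"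
  by (simp add: bscalar_def fps_of_nat)

text \<open>
  Terms of total degree below \<open>n\<close> vanish. Congruence of \<open>F\<close> and \<open>G\<close> in degrees below \<open>n\<close> is expressed
  as \<open>order_ge n (F - G)\<close>.
\<close>

definition order_ge :: "nat \<Rightarrow> bps \<Rightarrow> bool" where
  "order_ge n F \<longleftrightarrow> (\<forall>p q. p + q < n \<longrightarrow> bcoeff F p q = 0)"

lemma order_geD: "order_ge n F \<Longrightarrow> p + q < n \<Longrightarrow> bcoeff F p q = 0"
  by (simp add: order_ge_def)

lemma order_ge_trivial [simp]: "order_ge 0 F" "order_ge n 0"
  by (simp_all add: order_ge_def)

lemma order_ge_mono: "order_ge n F \<Longrightarrow> k \<le> n \<Longrightarrow> order_ge k F"
  by (simp add: order_ge_def)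

lemma order_ge_add: "order_ge n F \<Longrightarrow> order_ge n G \<Longrightarrow> order_ge n (F + G)"
  by (simp add: order_ge_def)

lemma order_ge_diff: "order_ge n F \<Longrightarrow> order_ge n G \<Longrightarrow> order_ge n (F - G)"
  by (simp add: order_ge_def)

lemma order_ge_mult:
  assumes "order_ge k F" "order_ge n G"
  shows "order_ge (k + n) (F * G)"
proof (unfold order_ge_def, intro allI impI)
  fix p q :: nat assume less: "p + q < k + n"
  have "bcoeff F j i * bcoeff G (p - j) (q - i) = 0" if "i \<le> q" "j \<le> p" for i j
  proof (cases "j + i < k")
    case True
    then show ?thesis using order_geD[OF assms(1)] by simp
  next
    case False
    then have "(p - j) + (q - i) < n" using less that by linarith
    then show ?thesis using order_geD[OF assms(2)] by simp
  qed
  then show "bcoeff (F * G) p q = 0"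
    unfolding bcoeff_mult by (intro sum.neutral ballI) auto
qed

lemma order_ge_mult_left: "order_ge n G \<Longrightarrow> order_ge n (F * G)"
  using order_ge_mult[of 0 F n G] by simp

lemma order_ge_mult_right: "order_ge n F \<Longrightarrow> order_ge n (F * G)"
  using order_ge_mult[of n F 0 G] by simp

lemma order_ge_power: "order_ge 1 F \<Longrightarrow> order_ge n (F ^ n)"
  by (induction n) (use order_ge_mult[of 1 F] in auto)

lemma order_ge_xi: "order_ge 1 xi" and order_ge_xj: "order_ge 1 xj"
  by (auto simp: order_ge_def bcoeff_def xi_def xj_def)

lemma order_ge_monomial: "order_ge (k + l) (xi ^ k * xj ^ l)"
  by (intro order_ge_mult order_ge_power order_ge_xi order_ge_xj)

lemma order_ge_mult_minus_one:
  "order_ge n (F * G - 1)" if "order_ge n (F - 1)" "order_ge n (G - 1)"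
proof -
  have "F * G - 1 = (F - 1) * G + (G - 1)" by (simp add: algebra_simps)
  then show ?thesis using that by (simp only: order_ge_add order_ge_mult_right)
qed

lemma order_ge_power_minus_one: "order_ge n (F ^ k - 1)" if "order_ge n (F - 1)"
  by (induction k) (use that in \<open>auto intro: order_ge_mult_minus_one\<close>)

text \<open>
  A factor with constant term 1 does not affect the lowest order terms; most of the leading term
  computations below reduce to this.
\<close>

lemma unit_mult_cong:
  "order_ge (Suc n) (F * H - H)" if "order_ge 1 (F - 1)" "order_ge n H"
proof -
  have "F * H - H = (F - 1) * H" by (simp add: algebra_simps)
  then show ?thesis using order_ge_mult[OF that] by simp
qed

text \<open>
  The derivative of the \<open>k\<close>-th power at 1 is \<open>k\<close>, so passing to \<open>k\<close>-th powers multiplies the leading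
  term of a difference by \<open>k\<close>.
\<close>

lemma power_diff_cong:
  assumes "order_ge 1 (F - 1)" "order_ge 1 (G - 1)" "order_ge n (F - G)"
  shows "order_ge (Suc n) (F ^ k - G ^ k - of_nat k * (F - G))"
proof (induction k)
  case (Suc k)
  have "F ^ Suc k - G ^ Suc k - of_nat (Suc k) * (F - G)
      = F * (F ^ k - G ^ k - of_nat k * (F - G))
        + of_nat k * (F * (F - G) - (F - G)) + (G ^ k * (F - G) - (F - G))"
    by (simp add: algebra_simps)
  moreover have "order_ge 1 (G ^ k - 1)" using assms(2) by (rule order_ge_power_minus_one)
  ultimately show ?case
    using Suc assms by (simp add: order_ge_add order_ge_mult_left unit_mult_cong)
qed simp

lemma power_cong: "order_ge n (F ^ k - G ^ k)" if "order_ge n (F - G)"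
proof (induction k)
  case (Suc k)
  have "F ^ Suc k - G ^ Suc k = F * (F ^ k - G ^ k) + (F - G) * G ^ k"
    by (simp add: algebra_simps)
  then show ?case using Suc that
    by (simp add: order_ge_add order_ge_mult_left order_ge_mult_right)
qed simp

section \<open>Continuous linear maps\<close>

text \<open>
  Continuity refers to the filtration by total degree. The third clause allows a loss of degree
  because partial derivatives lower the degree by one.
\<close>

definition cont_linear :: "(bps \<Rightarrow> bps) \<Rightarrow> bool" where
  "cont_linear \<Phi> \<longleftrightarrow> (\<forall>F G. \<Phi> (F + G) = \<Phi> F + \<Phi> G) \<and>
     (\<forall>c F. \<Phi> (bscalar c * F) = bscalar c * \<Phi> F) \<and>
     (\<forall>n. \<exists>k. \<forall>F. order_ge k F \<longrightarrow> order_ge n (\<Phi> F))"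

lemma cont_linear_zero: "\<Phi> 0 = 0" if "cont_linear \<Phi>"
  using that unfolding cont_linear_def by (metis add_cancel_left_left)

lemma cont_linear_diff: "\<Phi> (F - G) = \<Phi> F - \<Phi> G" if "cont_linear \<Phi>"
  using that unfolding cont_linear_def by (metis add_diff_cancel diff_add_cancel)

lemma cont_linear_sum: "\<Phi> (sum f S) = (\<Sum>s\<in>S. \<Phi> (f s))" if "cont_linear \<Phi>"
  by (induction S rule: infinite_finite_induct)
    (use that in \<open>auto simp: cont_linear_zero cont_linear_def\<close>)

lemma monomials_dense:
  "order_ge n (F - (\<Sum>k<n. \<Sum>l<n. bscalar (bcoeff F k l) * (xi ^ k * xj ^ l)))"
proof (unfold order_ge_def, intro allI impI)
  fix p q :: nat assume "p + q < n"
  then have "p < n" "q < n" by auto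
  have "(\<Sum>l<n. bcoeff F k l * bcoeff (xi ^ k * xj ^ l) p q)
      = (if p = k then bcoeff F p q else 0)" for k
    using \<open>q < n\<close> by (simp add: bcoeff_monomial if_distrib[of "(*) _"] cong: if_cong)
  then show "bcoeff (F - (\<Sum>k<n. \<Sum>l<n. bscalar (bcoeff F k l) * (xi ^ k * xj ^ l))) p q = 0"
    using \<open>p < n\<close> by simp
qed

text \<open>
  Up to any given degree a series is a finite combination of monomials, so a continuous linear map
  is determined by its values on these.
\<close>

lemma cont_linear_eqI:
  assumes "cont_linear \<Phi>" "cont_linear \<Psi>"
    and mono: "\<And>k l. \<Phi> (xi ^ k * xj ^ l) = \<Psi> (xi ^ k * xj ^ l)"
  shows "\<Phi> F = \<Psi> F"
proof (rule bcoeff_ext)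
  fix p q
  let ?n = "Suc (p + q)"
  obtain k1 where k1: "\<And>F. order_ge k1 F \<Longrightarrow> order_ge ?n (\<Phi> F)"
    using assms(1) unfolding cont_linear_def by metis
  obtain k2 where k2: "\<And>F. order_ge k2 F \<Longrightarrow> order_ge ?n (\<Psi> F)"
    using assms(2) unfolding cont_linear_def by metis
  define k where "k = max k1 k2"
  define H where "H = (\<Sum>a<k. \<Sum>l<k. bscalar (bcoeff F a l) * (xi ^ a * xj ^ l))"
  have H: "order_ge k (F - H)" unfolding H_def by (rule monomials_dense)
  have "\<Phi> H = \<Psi> H"
    using assms unfolding H_def by (simp add: cont_linear_sum) (simp add: cont_linear_def)
  moreover have "order_ge ?n (\<Phi> (F - H))" "order_ge ?n (\<Psi> (F - H))"
    using k1 k2 H order_ge_mono unfolding k_def by (meson max.cobounded1 max.cobounded2)+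
  ultimately have "order_ge ?n (\<Phi> F - \<Psi> F)"
    using order_ge_diff[of ?n "\<Phi> (F - H)" "\<Psi> (F - H)"] assms by (simp add: cont_linear_diff)
  then have "bcoeff (\<Phi> F - \<Psi> F) p q = 0" by (rule order_geD) simp
  then show "bcoeff (\<Phi> F) p q = bcoeff (\<Psi> F) p q" by simp
qed

lemma cont_linear_comp: "cont_linear (\<lambda>F. \<Phi> (\<Psi> F))" if "cont_linear \<Phi>" "cont_linear \<Psi>"
  using that unfolding cont_linear_def by (simp, metis)

lemma cont_linear_add:
  assumes "cont_linear \<Phi>" "cont_linear \<Psi>"
  shows "cont_linear (\<lambda>F. \<Phi> F + \<Psi> F)"
  unfolding cont_linear_def
proof (intro conjI allI)
  fix n
  obtain k1 where k1: "\<And>F. order_ge k1 F \<Longrightarrow> order_ge n (\<Phi> F)"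
    using assms(1) unfolding cont_linear_def by metis
  obtain k2 where k2: "\<And>F. order_ge k2 F \<Longrightarrow> order_ge n (\<Psi> F)"
    using assms(2) unfolding cont_linear_def by metis
  have "order_ge n (\<Phi> F + \<Psi> F)" if "order_ge (max k1 k2) F" for F
    using k1 k2 order_ge_add order_ge_mono[OF that] by simp
  then show "\<exists>k. \<forall>F. order_ge k F \<longrightarrow> order_ge n (\<Phi> F + \<Psi> F)" by blast
qed (use assms in \<open>simp_all add: cont_linear_def algebra_simps\<close>)

lemma cont_linear_mult_right: "cont_linear (\<lambda>F. F * G)"
  unfolding cont_linear_def using order_ge_mult_right by (auto simp: algebra_simps)

lemma cont_linear_mult_left: "cont_linear (\<lambda>F. G * F)"
  using cont_linear_mult_right[of G] by (simp add: mult.commute)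

section \<open>Substitution\<close>

lemma order_ge_monomial_subst:
  "order_ge (k + l) (A ^ k * B ^ l)" if "order_ge 1 A" "order_ge 1 B"
  using that by (intro order_ge_mult order_ge_power)

lemma order_ge_bsubst:
  assumes "order_ge 1 A" "order_ge 1 B" "order_ge n F"
  shows "order_ge n (bsubst A B F)"
proof (unfold order_ge_def, intro allI impI)
  fix p q :: nat assume less: "p + q < n"
  have "bcoeff F k l * bcoeff (A ^ k * B ^ l) p q = 0" for k l
  proof (cases "k + l < n")
    case True
    then show ?thesis using order_geD[OF assms(3)] by simp
  next
    case False
    then have "p + q < k + l" using less by linarith
    then show ?thesis using order_geD[OF order_ge_monomial_subst[OF assms(1,2)]] by simp
  qed
  then show "bcoeff (bsubst A B F) p q = 0"
    unfolding bsubst_def bcoeff_bps_of by (intro sum.neutral ballI)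
qed

lemma cont_linear_bsubst: "cont_linear (bsubst A B)" if "order_ge 1 A" "order_ge 1 B"
  unfolding cont_linear_def
proof (intro conjI allI)
  show "bsubst A B (F + G) = bsubst A B F + bsubst A B G" for F G
    by (rule bcoeff_ext) (simp add: bsubst_def algebra_simps sum.distrib)
  show "bsubst A B (bscalar c * F) = bscalar c * bsubst A B F" for c F
    by (rule bcoeff_ext) (simp add: bsubst_def sum_distrib_left mult.assoc)
  show "\<exists>k. \<forall>F. order_ge k F \<longrightarrow> order_ge n (bsubst A B F)" for n
    using order_ge_bsubst[OF that] by blast
qed

text \<open>
  When \<open>k\<close> or \<open>l\<close> exceeds \<open>p + q\<close>, the truncated sum that defines the substitution omits the only
  relevant term, but then the coefficient of \<open>A\<^sup>k B\<^sup>l\<close> vanishes as well.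
\<close>

lemma bsubst_monomial:
  assumes "order_ge 1 A" "order_ge 1 B"
  shows "bsubst A B (xi ^ k * xj ^ l) = A ^ k * B ^ l"
proof (rule bcoeff_ext)
  fix p q
  have "(\<Sum>l'\<le>p + q. bcoeff (xi ^ k * xj ^ l) k' l' * bcoeff (A ^ k' * B ^ l') p q)
     = (if k' = k then if l \<le> p + q then bcoeff (A ^ k * B ^ l) p q else 0 else 0)" for k'
    by (cases "k' = k") (simp_all add: bcoeff_monomial if_distrib[of "\<lambda>x. x * _"] cong: if_cong)
  then have "bcoeff (bsubst A B (xi ^ k * xj ^ l)) p q
     = (if k \<le> p + q \<and> l \<le> p + q then bcoeff (A ^ k * B ^ l) p q else 0)"
    by (simp add: bsubst_def)
  also have "\<dots> = bcoeff (A ^ k * B ^ l) p q"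
    using order_geD[OF order_ge_monomial_subst[OF assms], of p q k l] by auto
  finally show "bcoeff (bsubst A B (xi ^ k * xj ^ l)) p q = bcoeff (A ^ k * B ^ l) p q" .
qed

lemma bsubst_id: "bsubst xi xj F = F"
proof (rule cont_linear_eqI[of "bsubst xi xj" "\<lambda>F. F"])
  show "cont_linear (bsubst xi xj)" by (intro cont_linear_bsubst order_ge_xi order_ge_xj)
  show "cont_linear (\<lambda>F. F)" using cont_linear_mult_left[of 1] by simp
qed (rule bsubst_monomial[OF order_ge_xi order_ge_xj])

context
  fixes A B :: bps
  assumes A: "order_ge 1 A" and B: "order_ge 1 B"
begin

lemma bsubst_add: "bsubst A B (F + G) = bsubst A B F + bsubst A B G"
  and bsubst_bscalar_mult: "bsubst A B (bscalar c * F) = bscalar c * bsubst A B F"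
  using cont_linear_bsubst[OF A B] by (auto simp: cont_linear_def)

lemma bsubst_diff: "bsubst A B (F - G) = bsubst A B F - bsubst A B G"
  using cont_linear_diff[OF cont_linear_bsubst[OF A B]] .

text \<open>
  Both sides are continuous and linear in each of \<open>F\<close> and \<open>G\<close>, so the density of monomials can be
  used once for \<open>F\<close> and once for \<open>G\<close>.
\<close>

lemma bsubst_mult: "bsubst A B (F * G) = bsubst A B F * bsubst A B G"
proof -
  have cl: "cont_linear (bsubst A B)" by (rule cont_linear_bsubst[OF A B])
  have mono: "bsubst A B (F * (xi ^ k * xj ^ l)) = bsubst A B F * (A ^ k * B ^ l)" for F k l
  proof (rule cont_linear_eqI[of "\<lambda>F. bsubst A B (F * (xi ^ k * xj ^ l))"
        "\<lambda>F. bsubst A B F * (A ^ k * B ^ l)"])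
    fix k' l'
    have "xi ^ k' * xj ^ l' * (xi ^ k * xj ^ l) = xi ^ (k' + k) * xj ^ (l' + l)"
      by (simp add: power_add algebra_simps)
    then show "bsubst A B (xi ^ k' * xj ^ l' * (xi ^ k * xj ^ l))
        = bsubst A B (xi ^ k' * xj ^ l') * (A ^ k * B ^ l)"
      by (simp only: bsubst_monomial[OF A B]) (simp add: power_add algebra_simps)
  qed (rule cont_linear_comp[OF cl cont_linear_mult_right]
      cont_linear_comp[OF cont_linear_mult_right cl])+
  show ?thesis
    by (rule cont_linear_eqI[of "\<lambda>G. bsubst A B (F * G)" "\<lambda>G. bsubst A B F * bsubst A B G"])
      (rule cont_linear_comp[OF cl cont_linear_mult_left]
        cont_linear_comp[OF cont_linear_mult_left cl]
        mono[folded bsubst_monomial[OF A B]])+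
qed

lemma bsubst_1 [simp]: "bsubst A B 1 = 1"
  and bsubst_xi [simp]: "bsubst A B xi = A" and bsubst_xj [simp]: "bsubst A B xj = B"
  using bsubst_monomial[OF A B, of 0 0] bsubst_monomial[OF A B, of 1 0]
    bsubst_monomial[OF A B, of 0 1] by simp_all

lemma bsubst_bscalar [simp]: "bsubst A B (bscalar c) = bscalar c"
  using bsubst_bscalar_mult[of c 1] by simp

lemma bsubst_power: "bsubst A B (F ^ n) = bsubst A B F ^ n"
  by (induction n) (simp_all add: bsubst_mult)

lemma bsubst_bsubst:
  assumes "order_ge 1 C" "order_ge 1 D"
  shows "bsubst A B (bsubst C D F) = bsubst (bsubst A B C) (bsubst A B D) F"
proof (rule cont_linear_eqI[of "\<lambda>F. bsubst A B (bsubst C D F)"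
      "bsubst (bsubst A B C) (bsubst A B D)"])
  have CD: "order_ge 1 (bsubst A B C)" "order_ge 1 (bsubst A B D)"
    using order_ge_bsubst[OF A B] assms by auto
  show "cont_linear (\<lambda>F. bsubst A B (bsubst C D F))"
    by (rule cont_linear_comp[OF cont_linear_bsubst[OF A B] cont_linear_bsubst[OF assms]])
  show "cont_linear (bsubst (bsubst A B C) (bsubst A B D))"
    by (intro cont_linear_bsubst CD)
  show "bsubst A B (bsubst C D (xi ^ k * xj ^ l))
      = bsubst (bsubst A B C) (bsubst A B D) (xi ^ k * xj ^ l)" for k l
    by (simp only: bsubst_monomial[OF assms] bsubst_monomial[OF CD] bsubst_mult bsubst_power)
qed

end

lemma bsubst_cong:
  assumes "order_ge n (A - A')" "order_ge n (B - B')"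
  shows "order_ge n (bsubst A B F - bsubst A' B' F)"
proof -
  have "order_ge n (A ^ k * B ^ l - A' ^ k * B' ^ l)" for k l
  proof -
    have "A ^ k * B ^ l - A' ^ k * B' ^ l = A ^ k * (B ^ l - B' ^ l) + (A ^ k - A' ^ k) * B' ^ l"
      by (simp add: algebra_simps)
    then show ?thesis using assms
      by (simp add: order_ge_add order_ge_mult_left order_ge_mult_right power_cong)
  qed
  then have "bcoeff (A ^ k * B ^ l) p q = bcoeff (A' ^ k * B' ^ l) p q" if "p + q < n" for k l p q
    using order_geD that by fastforce
  then show ?thesis
    unfolding order_ge_def bsubst_def by simp
qed

text \<open>
  A substitution that changes the variables by relative corrections of order \<open>n\<close> changes a monomial
  of degree \<open>k\<close> by terms of degree at least \<open>k + n\<close>. This is the sense in which the automorphisms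
  act trivially on the graded pieces of the filtration.
\<close>

lemma bsubst_near_id:
  assumes "order_ge n (U - 1)" "order_ge n (V - 1)" "order_ge k F"
  shows "order_ge (k + n) (bsubst (xi * U) (xj * V) F - F)"
proof (unfold order_ge_def, intro allI impI)
  fix p q :: nat assume less: "p + q < k + n"
  have *: "bcoeff F a l * bcoeff ((xi * U) ^ a * (xj * V) ^ l) p q
      = bcoeff F a l * bcoeff (xi ^ a * xj ^ l) p q" for a l
  proof (cases "a + l < k")
    case True
    then show ?thesis using order_geD[OF assms(3)] by simp
  next
    case False
    have "(xi * U) ^ a * (xj * V) ^ l - xi ^ a * xj ^ l = (xi ^ a * xj ^ l) * (U ^ a * V ^ l - 1)"
      by (simp add: power_mult_distrib algebra_simps)
    moreover have "order_ge n (U ^ a * V ^ l - 1)"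
      using assms by (intro order_ge_mult_minus_one order_ge_power_minus_one)
    ultimately have "order_ge (a + l + n) ((xi * U) ^ a * (xj * V) ^ l - xi ^ a * xj ^ l)"
      using order_ge_mult[OF order_ge_monomial] by simp
    then have "bcoeff ((xi * U) ^ a * (xj * V) ^ l - xi ^ a * xj ^ l) p q = 0"
      by (rule order_geD) (use False less in linarith)
    then show ?thesis by simp
  qed
  have "bcoeff (bsubst (xi * U) (xj * V) F) p q = bcoeff (bsubst xi xj F) p q"
    unfolding bsubst_def by (simp add: *)
  then show "bcoeff (bsubst (xi * U) (xj * V) F - F) p q = 0" by (simp add: bsubst_id)
qed

section \<open>Derivations and the chain rule\<close>

definition cont_derivation :: "(bps \<Rightarrow> bps) \<Rightarrow> bool" where
  "cont_derivation \<delta> \<longleftrightarrow> cont_linear \<delta> \<and> (\<forall>F G. \<delta> (F * G) = \<delta> F * G + F * \<delta> G)"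

lemma bcoeff_deriv_i: "bcoeff (deriv_i F) p q = of_nat (Suc p) * bcoeff F (Suc p) q"
  by (simp add: bcoeff_def deriv_i_def)

lemma bcoeff_deriv_j: "bcoeff (deriv_j F) p q = of_nat (Suc q) * bcoeff F p (Suc q)"
proof -
  have "fps_nth (of_nat (Suc q) * fps_nth F (Suc q)) p = of_nat (Suc q) * bcoeff F p (Suc q)"
    unfolding fps_of_nat[symmetric] bcoeff_def by (rule fps_mult_left_const_nth)
  then show ?thesis by (simp add: bcoeff_def deriv_j_def)
qed

lemma cont_derivation_deriv_i: "cont_derivation deriv_i"
  unfolding cont_derivation_def cont_linear_def
proof (intro conjI allI)
  show "deriv_i (F + G) = deriv_i F + deriv_i G" for F G
    by (rule bcoeff_ext) (simp add: bcoeff_deriv_i algebra_simps)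
  show "deriv_i (bscalar c * F) = bscalar c * deriv_i F" for c F
    by (rule bcoeff_ext) (simp add: bcoeff_deriv_i)
  have "order_ge (Suc n) F \<longrightarrow> order_ge n (deriv_i F)" for n F
    by (simp add: order_ge_def bcoeff_deriv_i)
  then show "\<exists>k. \<forall>F. order_ge k F \<longrightarrow> order_ge n (deriv_i F)" for n by blast
  show "deriv_i (F * G) = deriv_i F * G + F * deriv_i G" for F G
    by (simp add: deriv_i_def fps_eq_iff[of "Abs_fps _"] fps_mult_nth fps_deriv_sum
        sum.distrib add.commute)
qed

lemma cont_derivation_deriv_j: "cont_derivation deriv_j"
  unfolding cont_derivation_def cont_linear_def
proof (intro conjI allI)
  show "deriv_j (F + G) = deriv_j F + deriv_j G" for F G
    by (simp add: deriv_j_def)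
  show "deriv_j (bscalar c * F) = bscalar c * deriv_j F" for c F
    by (rule bcoeff_ext) (simp add: bcoeff_deriv_j)
  have "order_ge (Suc n) F \<longrightarrow> order_ge n (deriv_j F)" for n F
    by (simp add: order_ge_def bcoeff_deriv_j)
  then show "\<exists>k. \<forall>F. order_ge k F \<longrightarrow> order_ge n (deriv_j F)" for n by blast
  show "deriv_j (F * G) = deriv_j F * G + F * deriv_j G" for F G
    by (simp add: deriv_j_def algebra_simps)
qed

lemma deriv_gens [simp]:
  "deriv_i xi = 1" "deriv_i xj = 0" "deriv_j xi = 0" "deriv_j xj = 1"
  by (rule bcoeff_ext, simp add: bcoeff_deriv_i bcoeff_deriv_j; simp add: bcoeff_def xi_def xj_def)+

context
  fixes \<delta>
  assumes der: "cont_derivation \<delta>"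
begin

lemma cont_linear_derivation: "cont_linear \<delta>"
  using der by (simp add: cont_derivation_def)

lemma derivation_mult: "\<delta> (F * G) = \<delta> F * G + F * \<delta> G"
  using der by (simp add: cont_derivation_def)

lemma derivation_add: "\<delta> (F + G) = \<delta> F + \<delta> G"
  using cont_linear_derivation by (simp add: cont_linear_def)

lemma derivation_1: "\<delta> 1 = 0"
  using derivation_mult[of 1 1] by simp

lemma derivation_power: "\<delta> (F ^ k) = of_nat k * F ^ (k - 1) * \<delta> F"
proof (induction k)
  case (Suc k)
  then show ?case
    by (cases k) (simp_all add: derivation_mult algebra_simps)
qed (simp add: derivation_1)

end

lemma deriv_i_monomial: "deriv_i (xi ^ k * xj ^ l) = bscalar (of_nat k) * (xi ^ (k - 1) * xj ^ l)"
  by (simp add: derivation_mult[OF cont_derivation_deriv_i]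
      derivation_power[OF cont_derivation_deriv_i] bscalar_of_nat algebra_simps)

lemma deriv_j_monomial: "deriv_j (xi ^ k * xj ^ l) = bscalar (of_nat l) * (xi ^ k * xj ^ (l - 1))"
  by (simp add: derivation_mult[OF cont_derivation_deriv_j]
      derivation_power[OF cont_derivation_deriv_j] bscalar_of_nat algebra_simps)

text \<open>
  For a general derivation, so that one proof serves \<open>deriv_i\<close> and \<open>deriv_j\<close>.
\<close>

lemma chain_rule:
  assumes der: "cont_derivation \<delta>" and A: "order_ge 1 A" and B: "order_ge 1 B"
  shows "\<delta> (bsubst A B F) = bsubst A B (deriv_i F) * \<delta> A + bsubst A B (deriv_j F) * \<delta> B"
proof (rule cont_linear_eqI[of "\<lambda>F. \<delta> (bsubst A B F)"
      "\<lambda>F. bsubst A B (deriv_i F) * \<delta> A + bsubst A B (deriv_j F) * \<delta> B"])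
  have cl: "cont_linear (bsubst A B)" by (rule cont_linear_bsubst[OF A B])
  show "cont_linear (\<lambda>F. \<delta> (bsubst A B F))"
    by (rule cont_linear_comp[OF cont_linear_derivation[OF der] cl])
  show "cont_linear (\<lambda>F. bsubst A B (deriv_i F) * \<delta> A + bsubst A B (deriv_j F) * \<delta> B)"
    by (intro cont_linear_add cont_linear_comp[OF cont_linear_mult_right cont_linear_comp[OF cl]]
        cont_linear_derivation cont_derivation_deriv_i cont_derivation_deriv_j)
  show "\<delta> (bsubst A B (xi ^ k * xj ^ l)) = bsubst A B (deriv_i (xi ^ k * xj ^ l)) * \<delta> A
      + bsubst A B (deriv_j (xi ^ k * xj ^ l)) * \<delta> B" for k l
    unfolding deriv_i_monomial deriv_j_monomial bsubst_bscalar_mult[OF A B]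
      bsubst_monomial[OF A B] derivation_mult[OF der] derivation_power[OF der]
    by (simp add: bscalar_of_nat algebra_simps)
qed

section \<open>Rational powers of a series with constant term 1\<close>

lemma bcoeff_fps_const: "bcoeff (fps_const f) k l = (if l = 0 then fps_nth f k else 0)"
  by (simp add: bcoeff_def)

text \<open>
  A power of \<open>U\<close> is the one-variable binomial series evaluated at \<open>U - 1\<close>. Through this the
  exponent laws, the derivative and the compatibility with substitutions are inherited from the
  binomial series. The variable \<open>x\<^sub>j\<close> does not occur in the series, and 0 is put in its place.
\<close>

lemma bpower_eq_bsubst: "bpower U s = bsubst (U - 1) 0 (fps_const (fps_binomial s))"
proof (rule bcoeff_ext)
  fix p q
  have "(\<Sum>l\<le>p + q. bcoeff (fps_const (fps_binomial s)) k l * bcoeff ((U - 1) ^ k * 0 ^ l) p q)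
      = (\<Sum>l\<le>p + q. if l = 0 then (s gchoose k) * bcoeff ((U - 1) ^ k) p q else 0)" for k
    by (intro sum.cong) (auto simp: bcoeff_fps_const)
  then show "bcoeff (bpower U s) p q = bcoeff (bsubst (U - 1) 0 (fps_const (fps_binomial s))) p q"
    by (simp add: bpower_def bsubst_def)
qed

context
  fixes U
  assumes U: "order_ge 1 (U - 1)"
begin

lemma bpower_add: "bpower U (s + t) = bpower U s * bpower U t"
  unfolding bpower_eq_bsubst bsubst_mult[OF U order_ge_trivial(2), symmetric]
  by (simp add: fps_binomial_add_mult)

lemma bpower_0 [simp]: "bpower U 0 = 1"
  unfolding bpower_eq_bsubst by (simp add: bsubst_1[OF U order_ge_trivial(2)])

lemma bpower_power: "bpower U s ^ n = bpower U (of_nat n * s)"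
  by (induction n) (simp_all add: bpower_add[symmetric] algebra_simps)

lemma bpower_derivation:
  assumes der: "cont_derivation \<delta>"
  shows "\<delta> (bpower U s) = bscalar s * bpower U (s - 1) * \<delta> U"
proof -
  have i: "deriv_i (fps_const (fps_binomial s)) = bscalar s * fps_const (fps_binomial (s - 1))"
  proof (rule bcoeff_ext)
    fix p q
    have "of_nat (Suc p) * (s gchoose Suc p) = s * (s - 1 gchoose p)"
      by (simp add: gbinomial_absorption' field_simps del: of_nat_Suc)
    then show "bcoeff (deriv_i (fps_const (fps_binomial s))) p q
        = bcoeff (bscalar s * fps_const (fps_binomial (s - 1))) p q"
      by (simp add: bcoeff_deriv_i bcoeff_fps_const del: of_nat_Suc)
  qed
  have j: "deriv_j (fps_const (fps_binomial s)) = 0"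
    by (simp add: deriv_j_def)
  have U': "\<delta> (U - 1) = \<delta> U"
    by (simp add: cont_linear_diff[OF cont_linear_derivation[OF der]] derivation_1[OF der])
  show ?thesis
    unfolding bpower_eq_bsubst chain_rule[OF der U order_ge_trivial(2)] i j U'
      bsubst_bscalar_mult[OF U order_ge_trivial(2)]
    by (simp add: cont_linear_zero[OF cont_linear_derivation[OF der]])
qed

lemma bpower_expansion:
  obtains H where "bpower U s = 1 + bscalar s * (U - 1) + (U - 1)\<^sup>2 * H"
proof -
  define h where "h = Abs_fps (\<lambda>n. s gchoose (Suc (Suc n)))"
  have "fps_binomial s = 1 + fps_const s * fps_X + fps_X * (fps_X * h)"
  proof (rule fps_ext)
    fix n
    show "fps_nth (fps_binomial s) n = fps_nth (1 + fps_const s * fps_X + fps_X * (fps_X * h)) n"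
      by (cases n rule: nat.exhaust; cases "n - 1") (auto simp: h_def)
  qed
  then have "fps_const (fps_binomial s) = 1 + bscalar s * xi + xi * (xi * fps_const h)"
    by (simp add: bscalar_def xi_def fps_const_add[symmetric] fps_const_mult[symmetric]
        del: fps_const_add fps_const_mult)
  then have "bpower U s = 1 + bscalar s * (U - 1) + (U - 1)\<^sup>2 * bsubst (U - 1) 0 (fps_const h)"
    using U by (simp add: bpower_eq_bsubst bsubst_add bsubst_mult bsubst_bscalar_mult
        power2_eq_square mult.assoc)
  then show thesis by (rule that)
qed

lemma bpower_linear_part:
  "order_ge (n + n) (bpower U s - 1 - bscalar s * (U - 1))" if "order_ge n (U - 1)"
proof -
  obtain H where "bpower U s = 1 + bscalar s * (U - 1) + (U - 1)\<^sup>2 * H"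
    by (rule bpower_expansion)
  then show ?thesis
    using order_ge_mult[OF that that] by (simp add: power2_eq_square order_ge_mult_right)
qed

lemma order_ge_bpower: "order_ge n (bpower U s - 1)" if "order_ge n (U - 1)"
  using order_ge_add[OF order_ge_mono[OF bpower_linear_part[OF that, of s]]
      order_ge_mult_left[OF that, of "bscalar s"]] by simp

lemma bsubst_bpower:
  assumes "order_ge 1 A" "order_ge 1 B"
  shows "bsubst A B (bpower U s) = bpower (bsubst A B U) s"
  unfolding bpower_eq_bsubst bsubst_bsubst[OF assms U order_ge_trivial(2)]
  by (simp add: bsubst_diff[OF assms] bsubst_1[OF assms]
      cont_linear_zero[OF cont_linear_bsubst[OF assms]])

end

section \<open>The automorphisms attached to one ray\<close>

definition ray :: "nat \<Rightarrow> nat \<Rightarrow> rat \<Rightarrow> bps" where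
  "ray a b s = bpower (1 + xi ^ a * xj ^ b) s"

lemma T_pow_eq:
  "T_pow m a b r = bsubst (xi * ray a b (- (of_nat m * of_nat b * r)))
     (xj * ray a b (of_nat m * of_nat a * r))"
  by (simp add: T_pow_def ray_def)

lemma order_ge_xi_mult: "order_ge 1 (xi * F)" and order_ge_xj_mult: "order_ge 1 (xj * F)"
  by (rule order_ge_mult_right[OF order_ge_xi] order_ge_mult_right[OF order_ge_xj])+

lemmas order_ge_gens = order_ge_xi_mult order_ge_xj_mult

context
  fixes a b :: nat
  assumes ab: "(a, b) \<noteq> (0, 0)"
begin

lemma ray_base: "order_ge 1 (1 + xi ^ a * xj ^ b - 1)"
proof -
  have "order_ge 1 (xi ^ a * xj ^ b)"
    by (rule order_ge_mono[OF order_ge_monomial]) (use ab in auto)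
  then show ?thesis by simp
qed

lemma ray_add: "ray a b (s + t) = ray a b s * ray a b t"
  and ray_0 [simp]: "ray a b 0 = 1"
  and ray_power: "ray a b s ^ n = ray a b (of_nat n * s)"
  using bpower_add bpower_0 bpower_power ray_base by (simp_all add: ray_def)

lemma order_ge_ray: "order_ge (a + b) (ray a b s - 1)"
  unfolding ray_def by (rule order_ge_bpower[OF ray_base]) (simp add: order_ge_monomial)

lemma order_ge_1_ray: "order_ge 1 (ray a b s - 1)"
  by (rule order_ge_mono[OF order_ge_ray]) (use ab in auto)

lemma ray_linear_part:
  "order_ge (Suc (a + b)) (ray a b s - 1 - bscalar s * (xi ^ a * xj ^ b))"
proof -
  have "order_ge (a + b + (a + b)) (ray a b s - 1 - bscalar s * (1 + xi ^ a * xj ^ b - 1))"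
    unfolding ray_def by (rule bpower_linear_part[OF ray_base]) (simp add: order_ge_monomial)
  then have "order_ge (a + b + (a + b)) (ray a b s - 1 - bscalar s * (xi ^ a * xj ^ b))"
    by simp
  then show ?thesis by (rule order_ge_mono) (use ab in auto)
qed

text \<open>
  The exponent is \<open>m r\<close> times the value of the symplectic form on \<open>(a, b)\<close> and \<open>(a', b')\<close>; in particular the
  monomials on the ray through \<open>(a, b)\<close> are fixed.
\<close>

lemma T_pow_monomial:
  "T_pow m a b r (xi ^ a' * xj ^ b')
     = xi ^ a' * xj ^ b' * ray a b (of_nat m * r * (of_nat a * of_nat b' - of_nat b * of_nat a'))"
proof -
  have "T_pow m a b r (xi ^ a' * xj ^ b')
      = xi ^ a' * xj ^ b' * (ray a b (of_nat a' * (- (of_nat m * of_nat b * r)))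
        * ray a b (of_nat b' * (of_nat m * of_nat a * r)))"
    by (simp only: T_pow_eq bsubst_monomial[OF order_ge_gens] power_mult_distrib ray_power mult_ac)
  also have "ray a b (of_nat a' * (- (of_nat m * of_nat b * r)))
        * ray a b (of_nat b' * (of_nat m * of_nat a * r))
      = ray a b (of_nat m * r * (of_nat a * of_nat b' - of_nat b * of_nat a'))"
    unfolding ray_add[symmetric] by (simp add: algebra_simps)
  finally show ?thesis .
qed

lemma T_pow_fixes_parallel_ray:
  assumes "(a', b') \<noteq> (0, 0)" "a * b' = b * a'"
  shows "T_pow m a b r (ray a' b' s) = ray a' b' s"
proof -
  have "of_nat a * of_nat b' = (of_nat b * of_nat a' :: rat)"
    using assms(2) by (metis of_nat_mult)
  then have "T_pow m a b r (xi ^ a' * xj ^ b') = xi ^ a' * xj ^ b'"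
    by (simp add: T_pow_monomial)
  then have "T_pow m a b r (1 + xi ^ a' * xj ^ b') = 1 + xi ^ a' * xj ^ b'"
    by (simp add: T_pow_eq bsubst_add[OF order_ge_gens] bsubst_1[OF order_ge_gens])
  moreover have "order_ge 1 (1 + xi ^ a' * xj ^ b' - 1)"
    by (rule order_ge_mono[of "a' + b'"]) (use assms in \<open>auto simp: order_ge_monomial\<close>)
  ultimately show ?thesis
    by (simp only: T_pow_eq ray_def bsubst_bpower[OF _ order_ge_gens])
qed

text \<open>
  The outer map fixes the series by which the inner one multiplies the variables, so these factors
  are simply multiplied. The result is symmetric, hence parallel automorphisms commute and exponents
  on one pair add up.
\<close>

lemma T_pow_comp_parallel:
  assumes "(a', b') \<noteq> (0, 0)" "a * b' = b * a'"
  shows "T_pow m a b r (T_pow m a' b' r' F) = bsubst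
     (xi * (ray a b (- (of_nat m * of_nat b * r)) * ray a' b' (- (of_nat m * of_nat b' * r'))))
     (xj * (ray a b (of_nat m * of_nat a * r) * ray a' b' (of_nat m * of_nat a' * r'))) F"
proof -
  have fix_ray: "bsubst (xi * ray a b (- (of_nat m * of_nat b * r)))
      (xj * ray a b (of_nat m * of_nat a * r)) (ray a' b' s) = ray a' b' s" for s
    using T_pow_fixes_parallel_ray[OF assms] by (simp add: T_pow_eq)
  show ?thesis
    unfolding T_pow_eq
    by (simp only: bsubst_bsubst[OF order_ge_gens order_ge_gens] bsubst_mult[OF order_ge_gens]
        bsubst_xi[OF order_ge_gens] bsubst_xj[OF order_ge_gens] fix_ray) (simp only: mult.assoc)
qed

lemma T_pow_inverse: "T_pow m a b r (T_pow m a b (- r) F) = F"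
  by (simp add: T_pow_comp_parallel[OF ab] ray_add[symmetric] bsubst_id mult.commute)

end

lemma T_pow_commute:
  assumes "(a, b) \<noteq> (0, 0)" "(a', b') \<noteq> (0, 0)" "a * b' = b * a'"
  shows "T_pow m a b r (T_pow m a' b' r' F) = T_pow m a' b' r' (T_pow m a b r F)"
proof -
  have "a' * b = b' * a" using assms(3) by (simp add: mult.commute)
  then show ?thesis
    unfolding T_pow_comp_parallel[OF assms] T_pow_comp_parallel[OF assms(2,1) \<open>a' * b = b' * a\<close>]
    by (simp only: mult.commute)
qed

section \<open>Poisson automorphisms\<close>

lemma poisson_product:
  "bracket m (xi * F) (xj * G) = of_nat m * xi * xj *
     ((F + xi * deriv_i F) * (G + xj * deriv_j G) - (xj * deriv_j F) * (xi * deriv_i G))"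
  by (simp add: bracket_def derivation_mult[OF cont_derivation_deriv_i]
      derivation_mult[OF cont_derivation_deriv_j] algebra_simps)

text \<open>
  By the chain rule the Jacobian determinant of a substitution is multiplicative, so preservation of
  the bracket needs to be checked on the two variables only.
\<close>

lemma bracket_bsubst:
  assumes A: "order_ge 1 A" and B: "order_ge 1 B" and AB: "bracket m A B = of_nat m * A * B"
  shows "bsubst A B (bracket m F G) = bracket m (bsubst A B F) (bsubst A B G)"
proof -
  define \<phi> where "\<phi> = bsubst A B"
  have m: "\<phi> (of_nat m) = of_nat m"
    unfolding \<phi>_def bscalar_of_nat[symmetric] by (rule bsubst_bscalar[OF A B])
  have "\<phi> (bracket m F G)
      = of_nat m * A * B * (\<phi> (deriv_i F) * \<phi> (deriv_j G) - \<phi> (deriv_j F) * \<phi> (deriv_i G))"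
    using m by (simp add: bracket_def \<phi>_def bsubst_mult[OF A B] bsubst_diff[OF A B]
        bsubst_xi[OF A B] bsubst_xj[OF A B])
  also have "\<dots> = bracket m A B *
      (\<phi> (deriv_i F) * \<phi> (deriv_j G) - \<phi> (deriv_j F) * \<phi> (deriv_i G))"
    by (simp only: AB)
  also have "\<dots> = bracket m (\<phi> F) (\<phi> G)"
    unfolding bracket_def \<phi>_def chain_rule[OF cont_derivation_deriv_i A B]
      chain_rule[OF cont_derivation_deriv_j A B] by (simp add: algebra_simps)
  finally show ?thesis by (simp add: \<phi>_def)
qed

text \<open>
  With \<open>w = x\<^sub>i\<^sup>a x\<^sub>j\<^sup>b\<close>, the variables are multiplied by powers \<open>(1 + w)\<^sup>\<alpha>\<close> and \<open>(1 + w)\<^sup>\<beta>\<close>. Both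
  are functions of \<open>w\<close>, so the quadratic terms of the Jacobian cancel, and the linear ones are
  proportional to \<open>\<alpha> a + \<beta> b\<close>, which is 0 for the exponents of \<open>T\<^sub>a\<^sub>,\<^sub>b\<^sup>r\<close>.
\<close>

lemma bracket_T_pow_gens:
  assumes ab: "(a, b) \<noteq> (0, 0)"
  shows "bracket m (xi * ray a b (- (of_nat m * of_nat b * r)))
       (xj * ray a b (of_nat m * of_nat a * r))
     = of_nat m * (xi * ray a b (- (of_nat m * of_nat b * r)))
       * (xj * ray a b (of_nat m * of_nat a * r))"
proof -
  define \<alpha> where "\<alpha> = - (of_nat m * of_nat b * r)"
  define \<beta> where "\<beta> = of_nat m * of_nat a * r"
  define w where "w = xi ^ a * xj ^ b"
  have "\<alpha> * of_nat a + \<beta> * of_nat b = 0" by (simp add: \<alpha>_def \<beta>_def)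
  then have "bscalar (\<alpha> * of_nat a + \<beta> * of_nat b) = 0" by simp
  then have zero: "bscalar \<alpha> * of_nat a + bscalar \<beta> * of_nat b = 0"
    by (simp add: bscalar_add bscalar_mult bscalar_of_nat)
  have wi: "xi * deriv_i (1 + w) = of_nat a * w" and wj: "xj * deriv_j (1 + w) = of_nat b * w"
    unfolding w_def derivation_add[OF cont_derivation_deriv_i]
      derivation_add[OF cont_derivation_deriv_j] derivation_1[OF cont_derivation_deriv_i]
      derivation_1[OF cont_derivation_deriv_j] deriv_i_monomial deriv_j_monomial bscalar_of_nat
    by (cases a; simp add: algebra_simps) (cases b; simp add: algebra_simps)
  have di: "xi * deriv_i (ray a b s) = bscalar s * ray a b (s - 1) * (of_nat a * w)" for s
    unfolding wi[symmetric] unfolding w_def ray_def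
      bpower_derivation[OF ray_base[OF ab] cont_derivation_deriv_i] by (simp only: mult_ac)
  have dj: "xj * deriv_j (ray a b s) = bscalar s * ray a b (s - 1) * (of_nat b * w)" for s
    unfolding wj[symmetric] unfolding w_def ray_def
      bpower_derivation[OF ray_base[OF ab] cont_derivation_deriv_j] by (simp only: mult_ac)
  have cross: "ray a b \<alpha> * ray a b (\<beta> - 1) = ray a b (\<alpha> - 1) * ray a b \<beta>"
    by (simp add: ray_add[OF ab, symmetric] algebra_simps)
  have "(ray a b \<alpha> + xi * deriv_i (ray a b \<alpha>)) * (ray a b \<beta> + xj * deriv_j (ray a b \<beta>))
      - (xj * deriv_j (ray a b \<alpha>)) * (xi * deriv_i (ray a b \<beta>))
      = ray a b \<alpha> * ray a b \<beta> + bscalar \<alpha> * of_nat a * w * (ray a b (\<alpha> - 1) * ray a b \<beta>)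
        + bscalar \<beta> * of_nat b * w * (ray a b \<alpha> * ray a b (\<beta> - 1))"
    unfolding di dj by (simp add: algebra_simps)
  also have "\<dots> = ray a b \<alpha> * ray a b \<beta>
      + (bscalar \<alpha> * of_nat a + bscalar \<beta> * of_nat b) * w * (ray a b (\<alpha> - 1) * ray a b \<beta>)"
    unfolding cross by (simp add: algebra_simps)
  finally show ?thesis
    unfolding zero poisson_product \<alpha>_def[symmetric] \<beta>_def[symmetric] by (simp add: mult_ac)
qed

lemma T_pow_poisson_aut:
  assumes ab: "(a, b) \<noteq> (0, 0)"
  shows "T_pow m a b r \<in> poisson_aut m"
proof -
  have "T_pow m a b (- r) (T_pow m a b r F) = F" for F
    using T_pow_inverse[OF ab, of m "- r"] by simp
  then have "bij (T_pow m a b r)"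
    by (intro o_bij[of "T_pow m a b (- r)"] ext) (simp_all add: T_pow_inverse[OF ab])
  then show ?thesis
    unfolding poisson_aut_def T_pow_eq mem_Collect_eq
    by (intro conjI allI bsubst_add[OF order_ge_gens] bsubst_mult[OF order_ge_gens]
        bsubst_bscalar[OF order_ge_gens]
        bracket_bsubst[OF order_ge_gens bracket_T_pow_gens[OF ab]])
qed

section \<open>Integral series\<close>

definition integral_coeffs :: "bps \<Rightarrow> bool" where
  "integral_coeffs F \<longleftrightarrow> (\<forall>p q. bcoeff F p q \<in> \<int>)"

lemma integral_1: "integral_coeffs 1"
  by (simp add: integral_coeffs_def)

lemma integral_monomial: "integral_coeffs (xi ^ k * xj ^ l)"
  by (simp add: integral_coeffs_def bcoeff_monomial)

lemma integral_mult: "integral_coeffs F \<Longrightarrow> integral_coeffs G \<Longrightarrow> integral_coeffs (F * G)"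
  by (auto simp: integral_coeffs_def bcoeff_mult intro!: Ints_sum Ints_mult)

lemma integral_power: "integral_coeffs F \<Longrightarrow> integral_coeffs (F ^ n)"
  by (induction n) (auto intro: integral_1 integral_mult)

lemma integral_bsubst:
  "integral_coeffs A \<Longrightarrow> integral_coeffs B \<Longrightarrow> integral_coeffs F \<Longrightarrow> integral_coeffs (bsubst A B F)"
  using integral_mult[OF integral_power integral_power, of A B]
  by (auto simp: integral_coeffs_def bsubst_def intro!: Ints_sum Ints_mult)

lemma gbinomial_Ints: "(s gchoose n) \<in> \<int>" if "s \<in> \<int>" for s :: rat
  using that by (auto elim!: Ints_cases simp flip: of_int_gbinomial)

text \<open>
  Binomial coefficients with integer upper argument, possibly negative, are integers.
\<close>

lemma integral_ray: "integral_coeffs (ray a b s)" if "s \<in> \<int>"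
  using integral_power[OF integral_monomial, of a b] gbinomial_Ints[OF that]
  by (auto simp: integral_coeffs_def ray_def bpower_def intro!: Ints_sum Ints_mult)

lemma integral_T_pow:
  assumes "of_nat a * r \<in> \<int>" "of_nat b * r \<in> \<int>" "integral_coeffs F"
  shows "integral_coeffs (T_pow m a b r F)"
proof -
  have "of_nat m * of_nat b * r \<in> \<int>" "of_nat m * of_nat a * r \<in> \<int>"
    using assms by (simp_all add: mult.assoc)
  then show ?thesis
    unfolding T_pow_eq using integral_monomial[of 1 0] integral_monomial[of 0 1] assms(3)
    by (simp add: integral_bsubst integral_mult integral_ray)
qed

section \<open>The multipliers of an ordered product\<close>

text \<open>
  The series \<open>F\<close> and \<open>G\<close> for which the ordered product over \<open>ps\<close> is the substitution
  \<open>x\<^sub>i \<mapsto> x\<^sub>i F\<^sup>m\<close>, \<open>x\<^sub>j \<mapsto> x\<^sub>j G\<^sup>m\<close>. They obey the same recursion (a cocycle condition) and differ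
  only in the exponents of the factors, \<open>- b d(a, b)\<close> for \<open>F\<close> and \<open>a d(a, b)\<close> for \<open>G\<close>; the weight
  \<open>w\<close> covers both.
\<close>

definition multiplier ::
    "nat \<Rightarrow> (nat \<Rightarrow> nat \<Rightarrow> rat) \<Rightarrow> (nat \<Rightarrow> nat \<Rightarrow> rat) \<Rightarrow> (nat \<times> nat) list \<Rightarrow> bps" where
  "multiplier m d w ps =
     foldr (\<lambda>(a, b) F. ray a b (w a b * d a b) * T_pow m a b (d a b) F) ps 1"

abbreviation weight_i :: "nat \<Rightarrow> nat \<Rightarrow> rat" where "weight_i \<equiv> \<lambda>a b. - of_nat b"

abbreviation weight_j :: "nat \<Rightarrow> nat \<Rightarrow> rat" where "weight_j \<equiv> \<lambda>a b. of_nat a"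

lemma multiplier_Nil [simp]: "multiplier m d w [] = 1"
  by (simp add: multiplier_def)

lemma multiplier_Cons [simp]:
  "multiplier m d w ((a, b) # ps)
     = ray a b (w a b * d a b) * T_pow m a b (d a b) (multiplier m d w ps)"
  by (simp add: multiplier_def)

lemma multiplier_cong:
  "(\<And>a b. (a, b) \<in> set ps \<Longrightarrow> d a b = d' a b) \<Longrightarrow> multiplier m d w ps = multiplier m d' w ps"
  unfolding multiplier_def by (rule foldr_cong) auto

lemma ordered_prod_eq_bsubst:
  "(0, 0) \<notin> set ps \<Longrightarrow> ordered_prod m d ps F
     = bsubst (xi * multiplier m d weight_i ps ^ m) (xj * multiplier m d weight_j ps ^ m) F"
proof (induction ps)
  case Nil
  show ?case by (simp add: ordered_prod_def bsubst_id)
next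
  case (Cons p ps)
  obtain a b where p: "p = (a, b)" by (cases p)
  have ab: "(a, b) \<noteq> (0, 0)" and ps: "(0, 0) \<notin> set ps" using Cons.prems p by auto
  define A where "A = xi * ray a b (- (of_nat m * of_nat b * d a b))"
  define B where "B = xj * ray a b (of_nat m * of_nat a * d a b)"
  have T: "T_pow m a b (d a b) = bsubst A B" by (simp add: T_pow_eq A_def B_def)
  have AB: "order_ge 1 A" "order_ge 1 B" unfolding A_def B_def by (rule order_ge_gens)+
  let ?X = "multiplier m d weight_i ps" and ?Y = "multiplier m d weight_j ps"
  have A: "xi * multiplier m d weight_i (p # ps) ^ m = bsubst A B (xi * ?X ^ m)"
    unfolding bsubst_mult[OF AB] bsubst_power[OF AB] bsubst_xi[OF AB]
    by (simp add: p T power_mult_distrib ray_power[OF ab] A_def mult.assoc)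
  have B: "xj * multiplier m d weight_j (p # ps) ^ m = bsubst A B (xj * ?Y ^ m)"
    unfolding bsubst_mult[OF AB] bsubst_power[OF AB] bsubst_xj[OF AB]
    by (simp add: p T power_mult_distrib ray_power[OF ab] B_def mult.assoc)
  have "ordered_prod m d (p # ps) F = bsubst A B (ordered_prod m d ps F)"
    by (simp add: ordered_prod_def p T)
  also have "\<dots> = bsubst (bsubst A B (xi * ?X ^ m)) (bsubst A B (xj * ?Y ^ m)) F"
    unfolding Cons.IH[OF ps] by (rule bsubst_bsubst[OF AB order_ge_gens])
  finally show ?case by (simp only: A B)
qed

lemma order_ge_T_pow: "order_ge n F \<Longrightarrow> order_ge n (T_pow m a b r F)"
  unfolding T_pow_eq by (rule order_ge_bsubst[OF order_ge_gens])

lemma T_pow_diff: "T_pow m a b r (F - G) = T_pow m a b r F - T_pow m a b r G"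
  unfolding T_pow_eq by (rule bsubst_diff[OF order_ge_gens])

lemma T_pow_mult: "T_pow m a b r (F * G) = T_pow m a b r F * T_pow m a b r G"
  unfolding T_pow_eq by (rule bsubst_mult[OF order_ge_gens])

lemma T_pow_of_1: "T_pow m a b r 1 = 1"
  unfolding T_pow_eq by (rule bsubst_1[OF order_ge_gens])

lemma T_pow_near_id:
  "order_ge k F \<Longrightarrow> (a, b) \<noteq> (0, 0) \<Longrightarrow> order_ge (k + (a + b)) (T_pow m a b r F - F)"
  unfolding T_pow_eq by (intro bsubst_near_id order_ge_ray)

lemma order_ge_multiplier:
  "(0, 0) \<notin> set ps \<Longrightarrow> order_ge 1 (multiplier m d w ps - 1)"
proof (induction ps)
  case (Cons p ps)
  obtain a b where p: "p = (a, b)" by (cases p)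
  have "order_ge 1 (T_pow m a b (d a b) (multiplier m d w ps) - 1)"
    using order_ge_T_pow[of 1 "multiplier m d w ps - 1"] Cons
    by (simp add: T_pow_diff T_pow_of_1)
  then show ?case
    using Cons.prems p by (simp only: multiplier_Cons) (intro order_ge_mult_minus_one order_ge_1_ray; auto)
qed simp

lemma integral_multiplier:
  assumes "\<And>a b. (a, b) \<in> set ps \<Longrightarrow> of_nat a * d a b \<in> \<int> \<and> of_nat b * d a b \<in> \<int> \<and> w a b * d a b \<in> \<int>"
  shows "integral_coeffs (multiplier m d w ps)"
  using assms
proof (induction ps)
  case (Cons p ps)
  then show ?case
    by (cases p) (simp add: integral_mult integral_ray integral_T_pow)
qed (simp add: integral_1)

text \<open>
  Factors of top degree \<open>n\<close> commute with everything up to terms of degree above \<open>n\<close>, so they can be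
  dropped from the list at the price of adding their own leading terms
  \<open>w(a, b) d(a, b) x\<^sub>i\<^sup>a x\<^sub>j\<^sup>b\<close>.
\<close>

lemma multiplier_top_degree:
  assumes "(0, 0) \<notin> set ps" "distinct ps" "\<And>a b. (a, b) \<in> set ps \<Longrightarrow> a + b \<le> n" "p + q \<le> n"
  shows "bcoeff (multiplier m d w ps) p q
     = bcoeff (multiplier m d w (filter (\<lambda>(a, b). a + b < n) ps)) p q
       + (if p + q = n \<and> (p, q) \<in> set ps then w p q * d p q else 0)"
  using assms
proof (induction ps arbitrary: p q)
  case (Cons r ps)
  obtain a b where r: "r = (a, b)" by (cases r)
  have ab: "(a, b) \<noteq> (0, 0)" and ps: "(0, 0) \<notin> set ps" and notin: "(a, b) \<notin> set ps"
    using Cons.prems r by auto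
  define M where "M = multiplier m d w ps"
  define M' where "M' = multiplier m d w (filter (\<lambda>(a, b). a + b < n) ps)"
  define R where "R = ray a b (w a b * d a b)"
  let ?T = "T_pow m a b (d a b)"
  have IH: "bcoeff M p q = bcoeff M' p q + (if p + q = n \<and> (p, q) \<in> set ps then w p q * d p q else 0)"
    if "p + q \<le> n" for p q
    unfolding M_def M'_def using Cons.prems that by (intro Cons.IH) auto
  have R1: "order_ge 1 (R - 1)" unfolding R_def by (rule order_ge_1_ray[OF ab])
  show ?case
  proof (cases "a + b < n")
    case True
    \<comment> \<open>A factor of lower degree acts on both multipliers, and it does not change the leading term
      of their difference, which has order \<open>n\<close>.\<close>
    define h where "h = M - M'"
    have h: "order_ge n h"
      using IH by (auto simp: order_ge_def h_def)
    have "order_ge (Suc n) (R * ?T h - ?T h)"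
      by (rule unit_mult_cong[OF R1 order_ge_T_pow[OF h]])
    moreover have "order_ge (Suc n) (?T h - h)"
      by (rule order_ge_mono[OF T_pow_near_id[OF h ab]]) (use ab in auto)
    ultimately have "order_ge (Suc n) (R * ?T h - h)"
      using order_ge_add[of "Suc n" "R * ?T h - ?T h" "?T h - h"] by simp
    then have "bcoeff (R * ?T h - h) p q = 0"
      by (rule order_geD) (use Cons.prems in auto)
    then have "bcoeff (R * ?T M) p q = bcoeff (R * ?T M') p q + bcoeff h p q"
      by (simp add: h_def T_pow_diff right_diff_distrib)
    moreover have "bcoeff h p q = (if p + q = n \<and> (p, q) \<in> set (r # ps) then w p q * d p q else 0)"
      using IH[OF Cons.prems(4)] True r by (auto simp: h_def)
    ultimately show ?thesis
      using True by (simp add: r M_def M'_def R_def)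
  next
    case False
    then have n: "n = a + b" using Cons.prems(3)[of a b] r by simp
    \<comment> \<open>A factor of degree \<open>n\<close> moves the remaining multiplier, whose constant term is 1, only in
      degrees above \<open>n\<close>, so that its own leading term is all it contributes.\<close>
    have M1: "order_ge 1 (M - 1)" unfolding M_def by (rule order_ge_multiplier[OF ps])
    have Rn: "order_ge n (R - 1)" unfolding R_def n by (rule order_ge_ray[OF ab])
    have "order_ge 1 (?T M - 1)"
      using order_ge_T_pow[OF M1] by (simp add: T_pow_diff T_pow_of_1)
    then have "order_ge (Suc n) ((R - 1) * (?T M - 1))"
      using order_ge_mult[OF Rn] by fastforce
    moreover have "order_ge (Suc n) (?T M - M)"
      using T_pow_near_id[OF M1 ab] by (simp add: T_pow_diff T_pow_of_1 n)
    moreover have "order_ge (Suc n) (R - 1 - bscalar (w a b * d a b) * (xi ^ a * xj ^ b))"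
      unfolding R_def n by (rule ray_linear_part[OF ab])
    ultimately have "order_ge (Suc n) ((R - 1) * (?T M - 1) + (?T M - M)
        + (R - 1 - bscalar (w a b * d a b) * (xi ^ a * xj ^ b)))"
      by (intro order_ge_add)
    also have "(R - 1) * (?T M - 1) + (?T M - M)
        + (R - 1 - bscalar (w a b * d a b) * (xi ^ a * xj ^ b))
        = R * ?T M - M - bscalar (w a b * d a b) * (xi ^ a * xj ^ b)"
      by (simp add: algebra_simps)
    finally have "bcoeff (R * ?T M - M - bscalar (w a b * d a b) * (xi ^ a * xj ^ b)) p q = 0"
      by (rule order_geD) (use Cons.prems in auto)
    then have "bcoeff (R * ?T M) p q
        = bcoeff M p q + (if (p, q) = (a, b) then w a b * d a b else 0)"
      by (auto simp: bcoeff_monomial diff_eq_eq split: if_splits)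
    then show ?thesis
      using False n notin IH[OF Cons.prems(4)] by (auto simp: r M_def M'_def R_def)
  qed
qed simp

section \<open>Independence of the enumeration\<close>

lemma foldr_move_to_front:
  assumes "\<And>x s. x \<in> set xs \<Longrightarrow> f x (f p s) = f p (f x s)"
  shows "foldr f (xs @ p # ys) e = f p (foldr f (xs @ ys) e)"
  using assms by (induction xs) auto

text \<open>
  The head of one list can only be preceded, in the other list, by elements with the same key, past
  which it can be moved.
\<close>

lemma foldr_sorted_unique:
  fixes key :: "'a \<Rightarrow> 'k :: linorder"
  assumes "\<And>x y s. x \<in> set xs \<Longrightarrow> y \<in> set xs \<Longrightarrow> key x = key y \<Longrightarrow> f x (f y s) = f y (f x s)"
    and "distinct xs" "distinct ys" "set xs = set ys"
    and "sorted_wrt (\<lambda>u v. key u \<ge> key v) xs" "sorted_wrt (\<lambda>u v. key u \<ge> key v) ys"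
  shows "foldr f xs e = foldr f ys e"
  using assms
proof (induction xs arbitrary: ys)
  case (Cons x xs)
  have "x \<in> set ys" using Cons.prems(4) by auto
  then obtain us vs where ys: "ys = us @ x # vs" by (meson split_list)
  have set_eq: "set xs = set (us @ vs)"
    using Cons.prems(2,3,4) ys by auto
  have "key u = key x" if "u \<in> set us" for u
    using that Cons.prems(5,6) ys set_eq by (fastforce simp: sorted_wrt_append intro: antisym)
  then have "foldr f ys e = f x (foldr f (us @ vs) e)"
    unfolding ys using Cons.prems(1)[of _ x] set_eq by (intro foldr_move_to_front) auto
  moreover have "foldr f xs e = foldr f (us @ vs) e"
    using Cons.prems ys set_eq by (intro Cons.IH) (auto simp: sorted_wrt_append)
  ultimately show ?case by simp
qed simp

lemma slope_eq_iff:
  assumes "(a, b) \<noteq> (0, 0)" "(a', b') \<noteq> (0, 0)" "slope (a, b) = slope (a', b')"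
  shows "a * b' = b * a'"
proof (cases "a = 0 \<or> a' = 0")
  case True
  then show ?thesis using assms by (auto simp: slope_def split: if_splits)
next
  case False
  then have "real b * real a' = real a * real b'"
    using assms(3) by (simp add: slope_def frac_eq_eq mult.commute)
  then show ?thesis by (metis of_nat_eq_iff of_nat_mult)
qed

lemma slope_enumD:
  assumes "slope_enum N ps"
  shows "(0, 0) \<notin> set ps" "distinct ps" "(a, b) \<in> set ps \<longleftrightarrow> 1 \<le> a + b \<and> a + b \<le> N"
  using assms by (auto simp: slope_enum_def)

lemma multiplier_enum_unique:
  assumes "slope_enum N ps" "slope_enum N qs"
  shows "multiplier m d w ps = multiplier m d w qs"
  unfolding multiplier_def
proof (rule foldr_sorted_unique[where key = slope])
  fix x y :: "nat \<times> nat" and s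
  assume xy: "x \<in> set ps" "y \<in> set ps" "slope x = slope y"
  obtain a b a' b' where *: "x = (a, b)" "y = (a', b')" by (cases x, cases y)
  have nz: "(a, b) \<noteq> (0, 0)" "(a', b') \<noteq> (0, 0)"
    using xy * slope_enumD(1)[OF assms(1)] by metis+
  have par: "a * b' = b * a'" using slope_eq_iff[OF nz] xy * by simp
  then have par': "a' * b = b' * a" by (simp add: mult.commute)
  show "(case x of (a, b) \<Rightarrow> \<lambda>F. ray a b (w a b * d a b) * T_pow m a b (d a b) F)
      ((case y of (a, b) \<Rightarrow> \<lambda>F. ray a b (w a b * d a b) * T_pow m a b (d a b) F) s)
    = (case y of (a, b) \<Rightarrow> \<lambda>F. ray a b (w a b * d a b) * T_pow m a b (d a b) F)
      ((case x of (a, b) \<Rightarrow> \<lambda>F. ray a b (w a b * d a b) * T_pow m a b (d a b) F) s)"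
    by (simp add: * T_pow_mult T_pow_fixes_parallel_ray[OF nz par]
        T_pow_fixes_parallel_ray[OF nz(2,1) par'] T_pow_commute[OF nz par] mult.left_commute)
qed (use assms in \<open>auto simp: slope_enum_def\<close>)

lemma slope_enum_filter:
  assumes "slope_enum (Suc N) ps"
  shows "slope_enum N (filter (\<lambda>(a, b). a + b < Suc N) ps)"
  using assms by (auto simp: slope_enum_def sorted_wrt_filter)

section \<open>The leading term of a Poisson automorphism\<close>

lemma bcoeff_euler_i: "bcoeff (xi * deriv_i F) p q = of_nat p * bcoeff F p q"
  by (cases p) (simp_all add: bcoeff_def xi_def deriv_i_def)

lemma bcoeff_euler_j: "bcoeff (xj * deriv_j F) p q = of_nat q * bcoeff F p q"
proof (cases q)
  case (Suc k)
  then have "bcoeff (xj * deriv_j F) p q = bcoeff (deriv_j F) p k"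
    by (simp add: bcoeff_def xj_def)
  then show ?thesis using Suc by (simp add: bcoeff_deriv_j)
qed (simp add: bcoeff_def xj_def)

lemma order_ge_euler:
  "order_ge n F \<Longrightarrow> order_ge n (xi * deriv_i F)" "order_ge n F \<Longrightarrow> order_ge n (xj * deriv_j F)"
  by (simp_all add: order_ge_def bcoeff_euler_i bcoeff_euler_j)

text \<open>
  The substitution \<open>x\<^sub>i \<mapsto> x\<^sub>i F\<close>, \<open>x\<^sub>j \<mapsto> x\<^sub>j G\<close> preserves the form
  \<open>dx\<^sub>i \<and> dx\<^sub>j / (x\<^sub>i x\<^sub>j)\<close>, which is dual to the Poisson bracket. The equation is
  \<open>poisson_product\<close> with the common factor \<open>m x\<^sub>i x\<^sub>j\<close> cancelled.
\<close>

definition log_volume_preserving :: "bps \<Rightarrow> bps \<Rightarrow> bool" where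
  "log_volume_preserving F G \<longleftrightarrow>
     (F + xi * deriv_i F) * (G + xj * deriv_j G) - (xj * deriv_j F) * (xi * deriv_i G) = F * G"

text \<open>
  Linearising the condition at the identity gives the vanishing of the divergence
  \<open>x\<^sub>i \<partial>f/\<partial>x\<^sub>i + x\<^sub>j \<partial>g/\<partial>x\<^sub>j\<close>. It holds for the lowest order terms of the difference of any two
  solutions with constant term 1, since the products of their other terms have higher order.
\<close>

lemma leading_divergence:
  assumes "log_volume_preserving F G" "log_volume_preserving F' G'"
    and F': "order_ge 1 (F' - 1)" and G': "order_ge 1 (G' - 1)"
    and f: "order_ge n (F' - F)" and g: "order_ge n (G' - G)" and pq: "p + q = n"
  shows "of_nat p * bcoeff (F' - F) p q + of_nat q * bcoeff (G' - G) p q = 0"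
proof -
  define i where "i = (\<lambda>F. xi * deriv_i F)"
  define j where "j = (\<lambda>F. xj * deriv_j F)"
  define f where "f = F' - F"
  define g where "g = G' - G"
  have i_diff: "i (F - G) = i F - i G" and j_diff: "j (F - G) = j F - j G" for F G
    by (rule bcoeff_ext, simp add: i_def j_def bcoeff_euler_i bcoeff_euler_j right_diff_distrib)+
  have ij1: "order_ge 1 (i F)" "order_ge 1 (j F)" for F
    unfolding i_def j_def by (rule order_ge_gens)+
  have fg: "order_ge n f" "order_ge n g" using assms by (simp_all add: f_def g_def)
  have ijfg: "order_ge n (i f)" "order_ge n (j f)" "order_ge n (i g)" "order_ge n (j g)"
    unfolding i_def j_def by (intro order_ge_euler fg)+
  have prod: "order_ge (Suc n) (X * Y)" if "order_ge n X" "order_ge 1 Y" for X Y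
    using order_ge_mult[OF that] by simp
  have "(F + i F) * (G + j G) - j F * i G = F * G"
    "(F' + i F') * (G' + j G') - j F' * i G' = F' * G'"
    using assms(1,2) by (simp_all add: log_volume_preserving_def i_def j_def)
  \<comment> \<open>Subtract the two equations and isolate the linear terms; each summand on the right has order
    above \<open>n\<close>.\<close>
  then have "i f + j g = - ((F' * j g - j g) + f * j G + (G' * i f - i f) + g * i F
      + i f * j G' + j g * i F - j f * i G' - i g * j F)"
    unfolding f_def g_def i_diff j_diff by algebra
  then have split: "i f + j g = 0 - ((F' * j g - j g) + f * j G + (G' * i f - i f) + g * i F
      + i f * j G' + j g * i F - j f * i G' - i g * j F)"
    by simp
  have "order_ge (Suc n) (i f + j g)"
    unfolding split
    by (intro order_ge_add order_ge_diff unit_mult_cong F' G' prod fg ijfg ij1 order_ge_trivial)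
  then have "bcoeff (i f + j g) p q = 0"
    by (rule order_geD) (simp add: pq)
  then show ?thesis by (simp add: i_def j_def bcoeff_euler_i bcoeff_euler_j f_def g_def)
qed

lemma bracket_ordered_prod:
  "(0, 0) \<notin> set ps \<Longrightarrow>
     ordered_prod m d ps (bracket m F G) = bracket m (ordered_prod m d ps F) (ordered_prod m d ps G)"
proof (induction ps)
  case (Cons p ps)
  obtain a b where p: "p = (a, b)" by (cases p)
  have "T_pow m a b (d a b) \<in> poisson_aut m"
    using Cons.prems p by (intro T_pow_poisson_aut) auto
  then show ?case
    using Cons by (simp add: ordered_prod_def p poisson_aut_def)
qed (simp add: ordered_prod_def)

lemma log_volume_preserving_multiplier:
  assumes "(0, 0) \<notin> set ps" "m \<ge> 1"
  shows "log_volume_preserving (multiplier m d weight_i ps ^ m) (multiplier m d weight_j ps ^ m)"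
proof -
  define F where "F = multiplier m d weight_i ps ^ m"
  define G where "G = multiplier m d weight_j ps ^ m"
  have prod: "ordered_prod m d ps X = bsubst (xi * F) (xj * G) X" for X
    unfolding F_def G_def by (rule ordered_prod_eq_bsubst[OF assms(1)])
  have "bracket m xi xj = bscalar (of_nat m) * (xi * xj)"
    by (simp add: bracket_def bscalar_of_nat)
  then have "bracket m (xi * F) (xj * G) = bscalar (of_nat m) * ((xi * F) * (xj * G))"
    using bracket_ordered_prod[OF assms(1), of m d xi xj]
    unfolding prod bsubst_xi[OF order_ge_gens] bsubst_xj[OF order_ge_gens]
    by (simp only: bsubst_bscalar[OF order_ge_gens] bsubst_mult[OF order_ge_gens]
        bsubst_xi[OF order_ge_gens] bsubst_xj[OF order_ge_gens])
  then have "bscalar (of_nat m) * xi * xj *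
     ((F + xi * deriv_i F) * (G + xj * deriv_j G) - (xj * deriv_j F) * (xi * deriv_i G))
     = bscalar (of_nat m) * xi * xj * (F * G)"
    unfolding poisson_product by (simp add: bscalar_of_nat mult_ac)
  moreover have "bscalar (of_nat m) * xi * xj \<noteq> 0"
    using assms(2) by (simp add: bscalar_def xi_def xj_def)
  ultimately show ?thesis
    unfolding log_volume_preserving_def F_def[symmetric] G_def[symmetric] mult_cancel_left by blast
qed

text \<open>
  The divergence condition concerns the \<open>m\<close>-th powers of the multipliers. Their leading differences
  are \<open>m\<close> times those of the multipliers, and \<open>m\<close> can be cancelled.
\<close>

lemma multiplier_leading_divergence:
  assumes "(0, 0) \<notin> set ps" "(0, 0) \<notin> set qs" "m \<ge> 1"
    and "order_ge n (multiplier m e weight_i qs - multiplier m d weight_i ps)"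
    and "order_ge n (multiplier m e weight_j qs - multiplier m d weight_j ps)"
    and "p + q = n"
  shows "of_nat p * bcoeff (multiplier m e weight_i qs - multiplier m d weight_i ps) p q
    + of_nat q * bcoeff (multiplier m e weight_j qs - multiplier m d weight_j ps) p q = 0"
proof -
  have lead: "bcoeff (multiplier m e w qs ^ m - multiplier m d w ps ^ m) p q
      = of_nat m * bcoeff (multiplier m e w qs - multiplier m d w ps) p q"
    if "order_ge n (multiplier m e w qs - multiplier m d w ps)" for w
  proof -
    have "order_ge (Suc n) (multiplier m e w qs ^ m - multiplier m d w ps ^ m
        - of_nat m * (multiplier m e w qs - multiplier m d w ps))"
      by (intro power_diff_cong order_ge_multiplier assms that)
    then have "bcoeff (multiplier m e w qs ^ m - multiplier m d w ps ^ m
        - of_nat m * (multiplier m e w qs - multiplier m d w ps)) p q = 0"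
      by (rule order_geD) (use assms in simp)
    then show ?thesis
      unfolding bscalar_of_nat[symmetric]
      by (simp only: bcoeff_diff bcoeff_bscalar_mult right_minus_eq)
  qed
  have "of_nat p * bcoeff (multiplier m e weight_i qs ^ m - multiplier m d weight_i ps ^ m) p q
    + of_nat q * bcoeff (multiplier m e weight_j qs ^ m - multiplier m d weight_j ps ^ m) p q = 0"
    by (rule leading_divergence[where n = n])
      (intro log_volume_preserving_multiplier order_ge_power_minus_one order_ge_multiplier
        power_cong assms)+
  then have "of_nat m * (of_nat p * bcoeff (multiplier m e weight_i qs - multiplier m d weight_i ps) p q
    + of_nat q * bcoeff (multiplier m e weight_j qs - multiplier m d weight_j ps) p q) = 0"
    unfolding lead[OF assms(4)] lead[OF assms(5)] by (simp only: algebra_simps)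
  then show ?thesis using assms(3) by simp
qed

section \<open>The factorization\<close>

text \<open>
  The multipliers of \<open>T\<^sub>i \<circ> T\<^sub>j\<close>, which is itself a product of powers \<open>T\<^sub>a\<^sub>,\<^sub>b\<^sup>r\<close>, although in the
  opposite order of slopes. Hence all general facts about multipliers apply to it.
\<close>

definition target :: "nat \<Rightarrow> (nat \<Rightarrow> nat \<Rightarrow> rat) \<Rightarrow> bps" where
  "target m w = multiplier m (\<lambda>_ _. 1) w [(1, 0), (0, 1)]"

lemma T_comp_eq_bsubst:
  "(T m 1 0 \<circ> T m 0 1) F = bsubst (xi * target m weight_i ^ m) (xj * target m weight_j ^ m) F"
  unfolding target_def
  by (subst ordered_prod_eq_bsubst[symmetric]) (simp_all add: ordered_prod_def T_def)

lemma order_ge_target: "order_ge 1 (target m w - 1)"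
  unfolding target_def by (rule order_ge_multiplier) simp

lemma integral_target: "integral_coeffs (target m weight_i)" "integral_coeffs (target m weight_j)"
  unfolding target_def by (rule integral_multiplier; auto)+

definition integral_exponents :: "nat \<Rightarrow> (nat \<Rightarrow> nat \<Rightarrow> rat) \<Rightarrow> bool" where
  "integral_exponents N d \<longleftrightarrow>
     (\<forall>a b. a + b \<le> N \<longrightarrow> of_nat a * d a b \<in> \<int> \<and> of_nat b * d a b \<in> \<int>)"

definition factors_upto :: "nat \<Rightarrow> nat \<Rightarrow> (nat \<Rightarrow> nat \<Rightarrow> rat) \<Rightarrow> bool" where
  "factors_upto m N d \<longleftrightarrow> (\<forall>ps. slope_enum N ps \<longrightarrow>
     order_ge (Suc N) (target m weight_i - multiplier m d weight_i ps) \<and>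
     order_ge (Suc N) (target m weight_j - multiplier m d weight_j ps))"

lemma factors_upto_0: "factors_upto m 0 d"
proof -
  have "ps = []" if "slope_enum 0 ps" for ps
    using that by (cases ps) (auto simp: slope_enum_def)
  then show ?thesis
    unfolding factors_upto_def using order_ge_target by (metis One_nat_def multiplier_Nil)
qed

lemma factors_upto_cong:
  assumes "\<And>a b. a + b \<le> N \<Longrightarrow> d a b = d' a b" "factors_upto m N d"
  shows "factors_upto m N d'"
proof -
  have "multiplier m d w ps = multiplier m d' w ps" if "slope_enum N ps" for w ps
    using assms(1) slope_enumD(3)[OF that] by (intro multiplier_cong) auto
  then show ?thesis using assms(2) by (simp add: factors_upto_def)
qed

text \<open>
  One step of the construction: the discrepancy \<open>(u, v)\<close> in degree \<open>N + 1\<close> determines the new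
  exponents and shows that they are integral, independently of the enumeration.
\<close>

lemma extend_factorization:
  assumes m: "m \<ge> 1" and int: "integral_exponents N d" and fac: "factors_upto m N d"
  shows "\<exists>d'. (integral_exponents (Suc N) d' \<and> factors_upto m (Suc N) d') \<and>
    (\<forall>a b. a + b \<le> N \<longrightarrow> d' a b = d a b)"
proof -
  obtain qs where qs: "slope_enum N qs" using slope_enum_exists by blast
  define u where "u = target m weight_i - multiplier m d weight_i qs"
  define v where "v = target m weight_j - multiplier m d weight_j qs"
  have uv: "order_ge (Suc N) u" "order_ge (Suc N) v"
    using fac qs by (simp_all add: factors_upto_def u_def v_def)
  have int_exps: "of_nat a * d a b \<in> \<int>" "of_nat b * d a b \<in> \<int>" if "(a, b) \<in> set qs" for a b
    using int that slope_enumD(3)[OF qs] by (auto simp: integral_exponents_def)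
  have "integral_coeffs (multiplier m d weight_i qs)" "integral_coeffs (multiplier m d weight_j qs)"
    using int_exps by (auto intro!: integral_multiplier)
  then have int_uv: "bcoeff u a b \<in> \<int>" "bcoeff v a b \<in> \<int>" for a b
    using integral_target[of m] by (auto simp: integral_coeffs_def u_def v_def)
  have div: "of_nat a * bcoeff u a b + of_nat b * bcoeff v a b = 0" if "a + b = Suc N" for a b
    unfolding u_def v_def target_def
    by (rule multiplier_leading_divergence[where n = "Suc N"])
      (use m uv that slope_enumD(1)[OF qs] in \<open>auto simp: u_def v_def target_def\<close>)
  \<comment> \<open>Solve \<open>- b d' = u\<close> and \<open>a d' = v\<close>. By \<open>div\<close> the two equations are compatible, and one with a
    nonzero coefficient is used.\<close>
  define d' where "d' = (\<lambda>a b. if a + b = Suc N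
    then (if b = 0 then bcoeff v a b / of_nat a else - bcoeff u a b / of_nat b) else d a b)"
  have d'_u: "- of_nat b * d' a b = bcoeff u a b" and d'_v: "of_nat a * d' a b = bcoeff v a b"
    if "a + b = Suc N" for a b
  proof -
    have eq: "of_nat b * bcoeff v a b = - (of_nat a * bcoeff u a b)"
      using div[OF that] by (simp add: add_eq_0_iff)
    show "- of_nat b * d' a b = bcoeff u a b" "of_nat a * d' a b = bcoeff v a b"
      using that eq by (cases "b = 0"; simp add: d'_def field_simps)+
  qed
  have "integral_exponents (Suc N) d'"
    unfolding integral_exponents_def
  proof (intro allI impI)
    fix a b :: nat assume "a + b \<le> Suc N"
    then consider "a + b \<le> N" | "a + b = Suc N" by linarith
    then show "of_nat a * d' a b \<in> \<int> \<and> of_nat b * d' a b \<in> \<int>"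
    proof cases
      case 1
      then show ?thesis using int by (simp add: d'_def integral_exponents_def)
    next
      case 2
      have "of_nat b * d' a b = - bcoeff u a b" using d'_u[OF 2] by simp
      then show ?thesis using d'_v[OF 2] int_uv by simp
    qed
  qed
  moreover have "factors_upto m (Suc N) d'"
    unfolding factors_upto_def
  proof (intro allI impI)
    fix ps assume ps: "slope_enum (Suc N) ps"
    define ps' where "ps' = filter (\<lambda>(a, b). a + b < Suc N) ps"
    have ps': "slope_enum N ps'" unfolding ps'_def by (rule slope_enum_filter[OF ps])
    have old: "multiplier m d' w ps' = multiplier m d w qs" for w
    proof -
      have "multiplier m d' w ps' = multiplier m d w ps'"
        using slope_enumD(3)[OF ps'] by (intro multiplier_cong) (auto simp: d'_def)
      then show ?thesis using multiplier_enum_unique[OF ps' qs] by simp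
    qed
    have new: "bcoeff (multiplier m d' w ps) p q = bcoeff (multiplier m d w qs) p q
        + (if p + q = Suc N then w p q * d' p q else 0)" if "p + q \<le> Suc N" for w p q
      using multiplier_top_degree[OF slope_enumD(1,2)[OF ps] _ that, of m d' w]
        slope_enumD(3)[OF ps]
      unfolding ps'_def[symmetric] old by auto
    have "bcoeff (target m w - multiplier m d' w ps) p q = 0"
      if "order_ge (Suc N) (target m w - multiplier m d w qs)"
        "\<And>a b. a + b = Suc N \<Longrightarrow> w a b * d' a b = bcoeff (target m w - multiplier m d w qs) a b"
        "p + q < Suc (Suc N)" for w p q
    proof (cases "p + q = Suc N")
      case True
      then show ?thesis using new[of p q w] that(2)[OF True] by simp
    next
      case False
      then have "p + q < Suc N" using that(3) by simp
      then show ?thesis using new[of p q w] order_geD[OF that(1)] by simp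
    qed
    then show "order_ge (Suc (Suc N)) (target m weight_i - multiplier m d' weight_i ps) \<and>
       order_ge (Suc (Suc N)) (target m weight_j - multiplier m d' weight_j ps)"
      using uv d'_u d'_v unfolding u_def v_def order_ge_def[of "Suc (Suc N)"] by blast
  qed
  moreover have "\<forall>a b. a + b \<le> N \<longrightarrow> d' a b = d a b" by (simp add: d'_def)
  ultimately show ?thesis by blast
qed

lemma factorization_exists:
  assumes "m \<ge> 1"
  shows "\<exists>d. \<forall>N. integral_exponents N d \<and> factors_upto m N d"
proof -
  have "\<exists>f. \<forall>N. (integral_exponents N (f N) \<and> factors_upto m N (f N)) \<and>
      (\<forall>a b. a + b \<le> N \<longrightarrow> f (Suc N) a b = f N a b)"
  proof (rule dependent_nat_choice[where P = "\<lambda>N d. integral_exponents N d \<and> factors_upto m N d"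
        and Q = "\<lambda>N d d'. \<forall>a b. a + b \<le> N \<longrightarrow> d' a b = d a b"])
    show "\<exists>d. integral_exponents 0 d \<and> factors_upto m 0 d"
      using factors_upto_0 by (intro exI[of _ "\<lambda>_ _. 0"]) (simp add: integral_exponents_def)
    show "\<exists>d'. (integral_exponents (Suc N) d' \<and> factors_upto m (Suc N) d') \<and>
        (\<forall>a b. a + b \<le> N \<longrightarrow> d' a b = d a b)"
      if "integral_exponents N d \<and> factors_upto m N d" for N d
      using extend_factorization[OF assms] that by simp
  qed
  then obtain f where f: "\<And>N. integral_exponents N (f N)" "\<And>N. factors_upto m N (f N)"
    and step: "\<And>N a b. a + b \<le> N \<Longrightarrow> f (Suc N) a b = f N a b" by blast
  \<comment> \<open>The approximations stabilise: the exponent of a pair never changes after its own degree.\<close>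
  define d where "d = (\<lambda>a b. f (a + b) a b)"
  have d: "f N a b = d a b" if "a + b \<le> N" for N a b
    using that by (induction N rule: dec_induct) (simp_all add: d_def step)
  have "integral_exponents N d" for N
    using f(1)[of N] d by (simp add: integral_exponents_def)
  moreover have "factors_upto m N d" for N
    by (rule factors_upto_cong[OF d f(2)])
  ultimately show ?thesis by blast
qed

lemma integral_over_gcd:
  fixes x :: rat
  assumes "(a, b) \<noteq> (0, 0)" "of_nat a * x \<in> \<int>" "of_nat b * x \<in> \<int>"
  shows "\<exists>k :: int. x = of_int k / of_nat (gcd a b)"
proof -
  obtain s t where "s * int a + t * int b = int (gcd a b)"
    using bezout_int[of "int a" "int b"] by (metis gcd_int_int_eq)
  then have "of_int s * of_nat a + of_int t * of_nat b = (of_nat (gcd a b) :: rat)"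
    by (metis of_int_add of_int_mult of_int_of_nat_eq)
  then have "of_nat (gcd a b) * x = of_int s * (of_nat a * x) + of_int t * (of_nat b * x)"
    by (metis distrib_right mult.assoc)
  also have "\<dots> \<in> \<int>" using assms(2,3) by (intro Ints_add Ints_mult[OF Ints_of_int])
  finally obtain k where "of_nat (gcd a b) * x = of_int k" by (elim Ints_cases)
  moreover have "gcd a b \<noteq> 0" using assms(1) by simp
  ultimately show ?thesis by (intro exI[of _ k]) (simp add: field_simps)
qed

text \<open>
  Agreement of the multipliers up to degree \<open>N\<close> gives agreement of all coefficients of degree at most
  \<open>N\<close> of the images of every series, so the coefficient of \<open>x\<^sub>i\<^sup>p x\<^sub>j\<^sup>q\<close> is constant from
  \<open>N = p + q\<close> on.
\<close>

lemma factors_imp_is_factorization: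
  assumes "\<And>N. factors_upto m N d"
  shows "is_factorization m d (T m 1 0 \<circ> T m 0 1)"
  unfolding is_factorization_def coeffwise_limit_def
proof (intro allI impI)
  fix ps F p q assume ps: "\<forall>N. slope_enum N (ps N)"
  have "bcoeff (ordered_prod m d (ps N) F) p q = bcoeff ((T m 1 0 \<circ> T m 0 1) F) p q"
    if "p + q \<le> N" for N
  proof -
    have gens: "order_ge (Suc N) (X * target m w ^ m - X * multiplier m d w (ps N) ^ m)"
      if "order_ge (Suc N) (target m w - multiplier m d w (ps N))" for X w
      unfolding right_diff_distrib[symmetric] by (rule order_ge_mult_left[OF power_cong[OF that]])
    have "order_ge (Suc N) ((T m 1 0 \<circ> T m 0 1) F - ordered_prod m d (ps N) F)"
      unfolding T_comp_eq_bsubst ordered_prod_eq_bsubst[OF slope_enumD(1)[OF ps[rule_format]]]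
      by (intro bsubst_cong gens) (use assms[of N] ps in \<open>auto simp: factors_upto_def\<close>)
    then have "bcoeff ((T m 1 0 \<circ> T m 0 1) F - ordered_prod m d (ps N) F) p q = 0"
      by (rule order_geD) (use that in simp)
    then show ?thesis by simp
  qed
  then show "\<forall>\<^sub>F N in sequentially.
      bcoeff (ordered_prod m d (ps N) F) p q = bcoeff ((T m 1 0 \<circ> T m 0 1) F) p q"
    unfolding eventually_sequentially by blast
qed

theorem theorem6p1:
  fixes m :: nat
  assumes "m \<ge> 1"
  shows "T m 1 0 \<in> poisson_aut m \<and> T m 0 1 \<in> poisson_aut m \<and>
    (\<exists>d :: nat \<Rightarrow> nat \<Rightarrow> rat.
       (\<forall>a b. (a, b) \<noteq> (0, 0) \<longrightarrow> T_pow m a b (d a b) \<in> poisson_aut m) \<and>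
       (\<forall>a b. (a, b) \<noteq> (0, 0) \<longrightarrow> (\<exists>k :: int. d a b = of_int k / of_nat (gcd a b))) \<and>
       is_factorization m d (T m 1 0 \<circ> T m 0 1))"
proof -
  obtain d where int: "\<And>N. integral_exponents N d" and fac: "\<And>N. factors_upto m N d"
    using factorization_exists[OF assms] by blast
  have "\<exists>k :: int. d a b = of_int k / of_nat (gcd a b)" if "(a, b) \<noteq> (0, 0)" for a b
    using int[of "a + b"] by (intro integral_over_gcd[OF that]) (simp_all add: integral_exponents_def)
  moreover have "is_factorization m d (T m 1 0 \<circ> T m 0 1)"
    by (rule factors_imp_is_factorization[OF fac])
  moreover have "T m 1 0 \<in> poisson_aut m" "T m 0 1 \<in> poisson_aut m"
    unfolding T_def by (rule T_pow_poisson_aut; simp)+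
  ultimately show ?thesis
    using T_pow_poisson_aut by blast
qed

end
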